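(* Let $\mathcal A$ be a full subcategory, closed under extensions, of an $n$-angulated category $\mathcal T$, and let $\mathfrak E$ be an almost $n$-exact structure for $\mathcal A$. (1) The following are equivalent: (a) there are enough $\mathfrak E$-injective morphisms; (b) $\Phi(\mathfrak E)$ is a precovering phantom $\mathcal A$-ideal. (2) The following are equivalent: (a) there are enough $\mathfrak E$-projective morphisms; (b) $\Phi(\mathfrak E)$ is a preenveloping phantom $\mathcal A$-ideal.
   Context: Let $n\geq 3$ be an integer. An $n$-angulated category is an additive category $\mathcal T$ with an automorphism $\Sigma$ and a collection of sequences $A_1\xrightarrow{\alpha_1}A_2\xrightarrow{\alpha_2}\cdots\xrightarrow{\alpha_{n-1}}A_n\xrightarrow{\alpha_n}\Sigma A_1$, called $n$-angles, satisfying the following (a morphism of such sequences is a tuple $(\varphi_1,\dots,\varphi_n)$ commuting with all maps, with $\Sigma\varphi_1$ on the last term). (F1) The collection is closed under direct sums and direct summands, contains $A\xrightarrow{1}A\to0\to\cdots\to0\to\Sigma A$ for all $A$, and every morphism $\alpha_1:A_1\to A_2$ is the first morphism of some $n$-angle. (F2) A sequence is an $n$-angle iff its left rotation $A_2\xrightarrow{\alpha_2}\cdots\xrightarrow{\alpha_n}\Sigma A_1\xrightarrow{(-1)^n\Sigma\alpha_1}\Sigma A_2$ is. (F3) Given two $n$-angles $(A_i,\alpha_i)$, $(B_i,\beta_i)$ and $\varphi_1,\varphi_2$ with $\varphi_2\alpha_1=\beta_1\varphi_1$, there are $\varphi_3,\dots,\varphi_n$ making $(\varphi_1,\dots,\varphi_n)$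 a morphism. (F4) In (F3) these can be chosen so that the cone $A_2\oplus B_1\to A_3\oplus B_2\to\cdots\to\Sigma A_1\oplus B_n\to\Sigma A_2\oplus\Sigma B_1$, with maps $\begin{pmatrix}-\alpha_{i+1}&0\\ \varphi_{i+1}&\beta_i\end{pmatrix}$ ($1\le i\le n-1$) and finally $\begin{pmatrix}-\Sigma\alpha_1&0\\ \Sigma\varphi_1&\beta_n\end{pmatrix}$, is an $n$-angle. An $n$-angle is split if $\alpha_n=0$. $\mathcal A\subseteq\mathcal T$ is a full subcategory, closed under isomorphisms and closed under extensions: for every $n$-angle with $A_1,A_n\in\mathcal A$ also $A_2,\dots,A_{n-1}\in\mathcal A$. $\mathfrak D_{\mathcal A}$ is the class of all $n$-angles with $A_1,\dots,A_n\in\mathcal A$. A class $\mathfrak E\subseteq\mathfrak D_{\mathcal A}$ is an almost $n$-exact structure for $\mathcal A$ if: (N1) $\mathfrak E$ is closed under direct sums and contains all split $n$-angles (in $\mathfrak D_{\mathcal A}$); (N2) if $\mathfrak d\in\mathfrak E$ has last morphism $\alpha_n:A_n\to\Sigma A_1$ and $f:B_n\to A_n$ is in $\mathcal A$, then every $n$-angle $A_1\to B_2\to\cdots\to B_n\xrightarrow{\alpha_nf}\Sigma A_1$ admitting a morphism of $n$-angles $(1_{A_1},*,\dots,*,f)$ to $\mathfrak d$ is in $\mathfrak E$; (N3) if $\mathfrak d\in\mathfrak E$ is as before and $g:A_1\to C_1$ is in $\mathcal A$, then every $n$-angle $C_1\to C_2\to\cdots\to A_n\xrightarrow{(\Sigma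 g)\alpha_n}\Sigma C_1$ receiving a morphism of $n$-angles $(g,*,\dots,*,1_{A_n})$ from $\mathfrak d$ is in $\mathfrak E$. For an $n$-angle in $\mathfrak E$, $\alpha_1$ is called an $\mathfrak E$-inflation, $\alpha_{n-1}$ an $\mathfrak E$-deflation and $\alpha_n$ an $\mathfrak E$-phantom; $\Phi(\mathfrak E)$ is the class of all $\mathfrak E$-phantoms. A morphism $f:X\to A$ in $\mathcal A$ is $\mathfrak E$-projective if it factors through every $\mathfrak E$-deflation $A_{n-1}\to A$; $g:A\to Y$ in $\mathcal A$ is $\mathfrak E$-injective if it factors through every $\mathfrak E$-inflation $A\to A_2$. There are enough $\mathfrak E$-injective morphisms if for every $A\in\mathcal A$ there is an $\mathfrak E$-inflation $A\to E$ which is $\mathfrak E$-injective; enough $\mathfrak E$-projective morphisms if for every $C\in\mathcal A$ there is an $\mathfrak E$-deflation $P\to C$ which is $\mathfrak E$-projective. A phantom $\mathcal A$-ideal is a class $\mathcal E$ of morphisms of $\mathcal T$ of the form $A\to\Sigma B$ with $A,B\in\mathcal A$, closed under sums of morphisms and such that $(\Sigma g)\,i\,f\in\mathcal E$ whenever $i\in\mathcal E$ and $f,g$ are morphisms of $\mathcal A$ for which the composite is defined. ($\Phi(\mathfrak E)$ is a phantom $\mathcal A$-ideal.) For $A\in\mathcal A$, an $\mathcal E$-precover of $\Sigma A$ is a morphism $\phi:X\to\Sigma A$ in $\mathcal E$ through which every $\phi':X'\to\Sigma A$ in $\mathcal E$ factors; for $B\in\mathcal A$, an $\mathcal E$-preenvelope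 of $B$ is a morphism $\phi:B\to\Sigma Y$ in $\mathcal E$ through which every $\phi':B\to\Sigma Y'$ in $\mathcal E$ factors. $\mathcal E$ is precovering if every object of $\Sigma\mathcal A$ has an $\mathcal E$-precover, and preenveloping if every object of $\mathcal A$ has an $\mathcal E$-preenvelope. *)

theory Defs
  imports "HOL-Algebra.Group"
begin

record ('o, 'm) add_cat =
  Obj  :: "'o set"
  Arr  :: "'m set"
  Dom  :: "'m \<Rightarrow> 'o"
  Cod  :: "'m \<Rightarrow> 'o"
  Ide  :: "'o \<Rightarrow> 'm"
  Comp :: "'m \<Rightarrow> 'm \<Rightarrow> 'm"  (infixr "\<cdot>\<index>" 75)
  Add  :: "'m \<Rightarrow> 'm \<Rightarrow> 'm"  (infixl "\<boxplus>\<index>" 65)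
  Zero :: "'o \<Rightarrow> 'o \<Rightarrow> 'm"

text \<open>Composition is written in the usual order: \<open>g \<cdot> f\<close> is ``first \<open>f\<close>, then \<open>g\<close>''.\<close>

definition Hom :: "('o, 'm, 'x) add_cat_scheme \<Rightarrow> 'o \<Rightarrow> 'o \<Rightarrow> 'm set" where
  "Hom T A B = {f \<in> Arr T. Dom T f = A \<and> Cod T f = B}"

definition hom_group :: "('o, 'm, 'x) add_cat_scheme \<Rightarrow> 'o \<Rightarrow> 'o \<Rightarrow> 'm monoid" where
  "hom_group T A B = \<lparr>carrier = Hom T A B, mult = Add T, one = Zero T A B\<rparr>"

definition Neg :: "('o, 'm, 'x) add_cat_scheme \<Rightarrow> 'm \<Rightarrow> 'm" where
  "Neg T f = inv\<^bsub>hom_group T (Dom T f) (Cod T f)\<^esub> f"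

definition zero_object :: "('o, 'm, 'x) add_cat_scheme \<Rightarrow> 'o \<Rightarrow> bool" where
  "zero_object T Z \<longleftrightarrow> Z \<in> Obj T \<and>
     (\<forall>A\<in>Obj T. (\<exists>!f. f \<in> Hom T A Z) \<and> (\<exists>!f. f \<in> Hom T Z A))"

definition biproduct ::
  "('o, 'm, 'x) add_cat_scheme \<Rightarrow> 'o \<Rightarrow> 'o \<Rightarrow> 'o \<Rightarrow> 'm \<Rightarrow> 'm \<Rightarrow> 'm \<Rightarrow> 'm \<Rightarrow> bool" where
  "biproduct T A B S i1 i2 p1 p2 \<longleftrightarrow>
     A \<in> Obj T \<and> B \<in> Obj T \<and> S \<in> Obj T \<and>
     i1 \<in> Hom T A S \<and> i2 \<in> Hom T B S \<and> p1 \<in> Hom T S A \<and> p2 \<in> Hom T S B \<and>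
     p1 \<cdot>\<^bsub>T\<^esub> i1 = Ide T A \<and> p2 \<cdot>\<^bsub>T\<^esub> i2 = Ide T B \<and>
     p1 \<cdot>\<^bsub>T\<^esub> i2 = Zero T B A \<and> p2 \<cdot>\<^bsub>T\<^esub> i1 = Zero T A B \<and>
     (i1 \<cdot>\<^bsub>T\<^esub> p1) \<boxplus>\<^bsub>T\<^esub> (i2 \<cdot>\<^bsub>T\<^esub> p2) = Ide T S"

definition isomorphic :: "('o, 'm, 'x) add_cat_scheme \<Rightarrow> 'o \<Rightarrow> 'o \<Rightarrow> bool" where
  "isomorphic T A B \<longleftrightarrow> A \<in> Obj T \<and> B \<in> Obj T \<and>
     (\<exists>f\<in>Hom T A B. \<exists>g\<in>Hom T B A. g \<cdot>\<^bsub>T\<^esub> f = Ide T A \<and> f \<cdot>\<^bsub>T\<^esub> g = Ide T B)"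

locale additive_category =
  fixes T (structure)
  assumes dom_in: "f \<in> Arr T \<Longrightarrow> Dom T f \<in> Obj T"
    and cod_in: "f \<in> Arr T \<Longrightarrow> Cod T f \<in> Obj T"
    and ide_in: "A \<in> Obj T \<Longrightarrow> Ide T A \<in> Hom T A A"
    and comp_in: "\<lbrakk>f \<in> Hom T A B; g \<in> Hom T B C\<rbrakk> \<Longrightarrow> g \<cdot> f \<in> Hom T A C"
    and comp_ide: "f \<in> Hom T A B \<Longrightarrow> f \<cdot> Ide T A = f"
    and ide_comp: "f \<in> Hom T A B \<Longrightarrow> Ide T B \<cdot> f = f"
    and comp_assoc: "\<lbrakk>f \<in> Hom T A B; g \<in> Hom T B C; h \<in> Hom T C D\<rbrakk>
           \<Longrightarrow> (h \<cdot> g) \<cdot> f = h \<cdot> (g \<cdot> f)"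
    and hom_comm_group: "\<lbrakk>A \<in> Obj T; B \<in> Obj T\<rbrakk> \<Longrightarrow> comm_group (hom_group T A B)"
    and comp_add: "\<lbrakk>f \<in> Hom T A B; f' \<in> Hom T A B; g \<in> Hom T B C\<rbrakk>
           \<Longrightarrow> g \<cdot> (f \<boxplus> f') = (g \<cdot> f) \<boxplus> (g \<cdot> f')"
    and add_comp: "\<lbrakk>f \<in> Hom T A B; g \<in> Hom T B C; g' \<in> Hom T B C\<rbrakk>
           \<Longrightarrow> (g \<boxplus> g') \<cdot> f = (g \<cdot> f) \<boxplus> (g' \<cdot> f)"
    and zero_object_exists: "\<exists>Z. zero_object T Z"
    and biproduct_exists: "\<lbrakk>A \<in> Obj T; B \<in> Obj T\<rbrakk>
           \<Longrightarrow> \<exists>S i1 i2 p1 p2. biproduct T A B S i1 i2 p1 p2"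

text \<open>
  \<open>SO\<close> and \<open>SA\<close> are the actions of the automorphism \<open>\<Sigma>\<close> on objects and on morphisms.

  A sequence \<open>A\<^sub>1 \<rightarrow> A\<^sub>2 \<rightarrow> \<dots> \<rightarrow> A\<^sub>n \<rightarrow> \<Sigma>A\<^sub>1\<close> is encoded as the list of its \<open>n\<close> morphisms, the objects
  being recovered as their domains.  Lists are indexed from 0, so \<open>\<alpha>\<^sub>i\<close> is \<open>\<alpha> ! (i - 1)\<close>; in
  particular \<open>\<alpha>\<^sub>1\<close>, \<open>\<alpha>\<^bsub>n-1\<^esub>\<close>, \<open>\<alpha>\<^sub>n\<close> are \<open>\<alpha> ! 0\<close>, \<open>\<alpha> ! (n - 2)\<close>, \<open>\<alpha> ! (n - 1)\<close>.
\<close>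

record ('o, 'm) ang_cat = "('o, 'm) add_cat" +
  SO :: "'o \<Rightarrow> 'o"
  SA :: "'m \<Rightarrow> 'm"
  Angles :: "'m list set"

definition automorphism :: "('o, 'm, 'x) ang_cat_scheme \<Rightarrow> bool" where
  "automorphism T \<longleftrightarrow>
     bij_betw (SO T) (Obj T) (Obj T) \<and> bij_betw (SA T) (Arr T) (Arr T) \<and>
     (\<forall>f\<in>Arr T. Dom T (SA T f) = SO T (Dom T f) \<and> Cod T (SA T f) = SO T (Cod T f)) \<and>
     (\<forall>A\<in>Obj T. SA T (Ide T A) = Ide T (SO T A)) \<and>
     (\<forall>f\<in>Arr T. \<forall>g\<in>Arr T. Cod T f = Dom T g \<longrightarrow>
        SA T (g \<cdot>\<^bsub>T\<^esub> f) = SA T g \<cdot>\<^bsub>T\<^esub> SA T f) \<and>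
     (\<forall>f\<in>Arr T. \<forall>g\<in>Arr T. Dom T f = Dom T g \<and> Cod T f = Cod T g \<longrightarrow>
        SA T (f \<boxplus>\<^bsub>T\<^esub> g) = SA T f \<boxplus>\<^bsub>T\<^esub> SA T g)"

definition sigma_seq :: "('o, 'm, 'x) ang_cat_scheme \<Rightarrow> nat \<Rightarrow> 'm list \<Rightarrow> bool" where
  "sigma_seq T n \<alpha> \<longleftrightarrow> length \<alpha> = n \<and> set \<alpha> \<subseteq> Arr T \<and>
     (\<forall>i. Suc i < n \<longrightarrow> Cod T (\<alpha> ! i) = Dom T (\<alpha> ! Suc i)) \<and>
     Cod T (\<alpha> ! (n - 1)) = SO T (Dom T (\<alpha> ! 0))"

definition seq_mor ::
  "('o, 'm, 'x) ang_cat_scheme \<Rightarrow> nat \<Rightarrow> 'm list \<Rightarrow> 'm list \<Rightarrow> 'm list \<Rightarrow> bool" where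
  "seq_mor T n \<alpha> \<beta> \<phi> \<longleftrightarrow> sigma_seq T n \<alpha> \<and> sigma_seq T n \<beta> \<and> length \<phi> = n \<and>
     (\<forall>i<n. \<phi> ! i \<in> Hom T (Dom T (\<alpha> ! i)) (Dom T (\<beta> ! i))) \<and>
     (\<forall>i. Suc i < n \<longrightarrow> \<phi> ! Suc i \<cdot>\<^bsub>T\<^esub> \<alpha> ! i = \<beta> ! i \<cdot>\<^bsub>T\<^esub> \<phi> ! i) \<and>
     SA T (\<phi> ! 0) \<cdot>\<^bsub>T\<^esub> \<alpha> ! (n - 1) = \<beta> ! (n - 1) \<cdot>\<^bsub>T\<^esub> \<phi> ! (n - 1)"

text \<open>
  Direct sums are only defined up to isomorphism, so \<open>seq_direct_sum T n \<alpha> \<beta> \<gamma>\<close> says that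
  \<open>\<gamma>\<close> is \<^emph>\<open>a\<close> direct sum of \<open>\<alpha>\<close> and \<open>\<beta>\<close>, i.e. a biproduct in the category of sequences.
\<close>

definition seq_direct_sum ::
  "('o, 'm, 'x) ang_cat_scheme \<Rightarrow> nat \<Rightarrow> 'm list \<Rightarrow> 'm list \<Rightarrow> 'm list \<Rightarrow> bool" where
  "seq_direct_sum T n \<alpha> \<beta> \<gamma> \<longleftrightarrow> (\<exists>i1 i2 p1 p2.
     seq_mor T n \<alpha> \<gamma> i1 \<and> seq_mor T n \<beta> \<gamma> i2 \<and> seq_mor T n \<gamma> \<alpha> p1 \<and> seq_mor T n \<gamma> \<beta> p2 \<and>
     (\<forall>k<n. biproduct T (Dom T (\<alpha> ! k)) (Dom T (\<beta> ! k)) (Dom T (\<gamma> ! k))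
                        (i1 ! k) (i2 ! k) (p1 ! k) (p2 ! k)))"

definition trivial_seq :: "('o, 'm, 'x) ang_cat_scheme \<Rightarrow> nat \<Rightarrow> 'o \<Rightarrow> 'o \<Rightarrow> 'm list" where
  "trivial_seq T n A Z =
     [Ide T A, Zero T A Z] @ replicate (n - 3) (Zero T Z Z) @ [Zero T Z (SO T A)]"

definition left_rotation :: "('o, 'm, 'x) ang_cat_scheme \<Rightarrow> nat \<Rightarrow> 'm list \<Rightarrow> 'm list" where
  "left_rotation T n \<alpha> =
     tl \<alpha> @ [if even n then SA T (hd \<alpha>) else Neg T (SA T (hd \<alpha>))]"

text \<open>
  \<open>matrix_entries T (i1,i2) (p1,p2) a b c d m\<close>: the morphism \<open>m\<close> between two biproducts has the
  matrix with first row \<open>a b\<close> and second row \<open>c d\<close>, where \<open>i1, i2\<close> are the injections of the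
  source and \<open>p1, p2\<close> the projections of the target.
\<close>

definition matrix_entries ::
  "('o, 'm, 'x) add_cat_scheme \<Rightarrow> 'm \<times> 'm \<Rightarrow> 'm \<times> 'm \<Rightarrow> 'm \<Rightarrow> 'm \<Rightarrow> 'm \<Rightarrow> 'm \<Rightarrow> 'm \<Rightarrow> bool" where
  "matrix_entries T ii pp a b c d m \<longleftrightarrow>
     fst pp \<cdot>\<^bsub>T\<^esub> m \<cdot>\<^bsub>T\<^esub> fst ii = a \<and> fst pp \<cdot>\<^bsub>T\<^esub> m \<cdot>\<^bsub>T\<^esub> snd ii = b \<and>
     snd pp \<cdot>\<^bsub>T\<^esub> m \<cdot>\<^bsub>T\<^esub> fst ii = c \<and> snd pp \<cdot>\<^bsub>T\<^esub> m \<cdot>\<^bsub>T\<^esub> snd ii = d"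

text \<open>
  \<open>\<gamma>\<close> is a mapping cone of \<open>\<phi> : \<alpha> \<rightarrow> \<beta>\<close>.  Its \<open>k\<close>-th object is a biproduct of the codomain of
  \<open>\<alpha> ! k\<close> (which is \<open>\<Sigma>A\<^sub>1\<close> for the last \<open>k\<close>) and the domain of \<open>\<beta> ! k\<close>.  The target of the last
  morphism is \<open>\<Sigma>(A\<^sub>2 \<oplus> B\<^sub>1)\<close>, identified with \<open>\<Sigma>A\<^sub>2 \<oplus> \<Sigma>B\<^sub>1\<close> through \<open>\<Sigma>\<close> of the first projections.
\<close>

definition is_cone ::
  "('o, 'm, 'x) ang_cat_scheme \<Rightarrow> nat \<Rightarrow> 'm list \<Rightarrow> 'm list \<Rightarrow> 'm list \<Rightarrow> 'm list \<Rightarrow> bool" where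
  "is_cone T n \<alpha> \<beta> \<phi> \<gamma> \<longleftrightarrow> sigma_seq T n \<gamma> \<and> (\<exists>i1 i2 p1 p2 :: nat \<Rightarrow> 'm.
     (\<forall>k<n. biproduct T (Cod T (\<alpha> ! k)) (Dom T (\<beta> ! k)) (Dom T (\<gamma> ! k))
                        (i1 k) (i2 k) (p1 k) (p2 k)) \<and>
     (\<forall>k. Suc k < n \<longrightarrow>
        matrix_entries T (i1 k, i2 k) (p1 (Suc k), p2 (Suc k))
          (Neg T (\<alpha> ! Suc k)) (Zero T (Dom T (\<beta> ! k)) (Cod T (\<alpha> ! Suc k)))
          (\<phi> ! Suc k)         (\<beta> ! k)
          (\<gamma> ! k)) \<and>
     matrix_entries T (i1 (n - 1), i2 (n - 1)) (SA T (p1 0), SA T (p2 0))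
       (Neg T (SA T (\<alpha> ! 0))) (Zero T (Dom T (\<beta> ! (n - 1))) (SO T (Cod T (\<alpha> ! 0))))
       (SA T (\<phi> ! 0))         (\<beta> ! (n - 1))
       (\<gamma> ! (n - 1)))"

locale n_angulated_category = additive_category T for T (structure) +
  fixes n :: nat
  assumes n_ge_3: "3 \<le> n"
    and automorphism: "automorphism T"
    and angles_seq: "\<alpha> \<in> Angles T \<Longrightarrow> sigma_seq T n \<alpha>"
    and F1_sum: "\<lbrakk>\<alpha> \<in> Angles T; \<beta> \<in> Angles T; seq_direct_sum T n \<alpha> \<beta> \<gamma>\<rbrakk> \<Longrightarrow> \<gamma> \<in> Angles T"
    and F1_summand: "\<lbrakk>\<gamma> \<in> Angles T; seq_direct_sum T n \<alpha> \<beta> \<gamma>\<rbrakk> \<Longrightarrow> \<alpha> \<in> Angles T"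
    and F1_trivial: "\<lbrakk>A \<in> Obj T; zero_object T Z\<rbrakk> \<Longrightarrow> trivial_seq T n A Z \<in> Angles T"
    and F1_first: "f \<in> Arr T \<Longrightarrow> \<exists>\<alpha>\<in>Angles T. \<alpha> ! 0 = f"
    and F2: "sigma_seq T n \<alpha> \<Longrightarrow> \<alpha> \<in> Angles T \<longleftrightarrow> left_rotation T n \<alpha> \<in> Angles T"
    and F3: "\<lbrakk>\<alpha> \<in> Angles T; \<beta> \<in> Angles T;
              \<phi>1 \<in> Hom T (Dom T (\<alpha> ! 0)) (Dom T (\<beta> ! 0));
              \<phi>2 \<in> Hom T (Dom T (\<alpha> ! 1)) (Dom T (\<beta> ! 1));
              \<phi>2 \<cdot> \<alpha> ! 0 = \<beta> ! 0 \<cdot> \<phi>1\<rbrakk>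
           \<Longrightarrow> \<exists>\<phi>. seq_mor T n \<alpha> \<beta> \<phi> \<and> \<phi> ! 0 = \<phi>1 \<and> \<phi> ! 1 = \<phi>2"
    and F4: "\<lbrakk>\<alpha> \<in> Angles T; \<beta> \<in> Angles T;
              \<phi>1 \<in> Hom T (Dom T (\<alpha> ! 0)) (Dom T (\<beta> ! 0));
              \<phi>2 \<in> Hom T (Dom T (\<alpha> ! 1)) (Dom T (\<beta> ! 1));
              \<phi>2 \<cdot> \<alpha> ! 0 = \<beta> ! 0 \<cdot> \<phi>1\<rbrakk>
           \<Longrightarrow> \<exists>\<phi>. seq_mor T n \<alpha> \<beta> \<phi> \<and> \<phi> ! 0 = \<phi>1 \<and> \<phi> ! 1 = \<phi>2 \<and>
                   (\<forall>\<gamma>. is_cone T n \<alpha> \<beta> \<phi> \<gamma> \<longrightarrow> \<gamma> \<in> Angles T)"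

text \<open>
  A full subcategory is given by its set \<open>\<A>\<close> of objects.  Closure under extensions is required for
  \<^emph>\<open>every\<close> \<open>n\<close>-angle with end terms in \<open>\<A>\<close>, not just for some \<open>n\<close>-angle with a given last morphism.
\<close>

definition ext_closed_subcategory :: "('o, 'm, 'x) ang_cat_scheme \<Rightarrow> nat \<Rightarrow> 'o set \<Rightarrow> bool" where
  "ext_closed_subcategory T n \<A> \<longleftrightarrow> \<A> \<subseteq> Obj T \<and>
     (\<forall>A B. A \<in> \<A> \<and> isomorphic T A B \<longrightarrow> B \<in> \<A>) \<and>
     (\<forall>\<alpha>\<in>Angles T. Dom T (\<alpha> ! 0) \<in> \<A> \<and> Dom T (\<alpha> ! (n - 1)) \<in> \<A> \<longrightarrow>
        (\<forall>k<n. Dom T (\<alpha> ! k) \<in> \<A>))"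

definition sub_arr :: "('o, 'm, 'x) add_cat_scheme \<Rightarrow> 'o set \<Rightarrow> 'm set" where
  "sub_arr T \<A> = {f \<in> Arr T. Dom T f \<in> \<A> \<and> Cod T f \<in> \<A>}"

definition angles_in :: "('o, 'm, 'x) ang_cat_scheme \<Rightarrow> nat \<Rightarrow> 'o set \<Rightarrow> 'm list set" where
  "angles_in T n \<A> = {\<alpha> \<in> Angles T. \<forall>k<n. Dom T (\<alpha> ! k) \<in> \<A>}"

definition split_angle :: "('o, 'm, 'x) ang_cat_scheme \<Rightarrow> nat \<Rightarrow> 'm list \<Rightarrow> bool" where
  "split_angle T n \<alpha> \<longleftrightarrow> \<alpha> \<in> Angles T \<and>
     \<alpha> ! (n - 1) = Zero T (Dom T (\<alpha> ! (n - 1))) (Cod T (\<alpha> ! (n - 1)))"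

definition almost_n_exact ::
  "('o, 'm, 'x) ang_cat_scheme \<Rightarrow> nat \<Rightarrow> 'o set \<Rightarrow> 'm list set \<Rightarrow> bool" where
  "almost_n_exact T n \<A> \<EE> \<longleftrightarrow> \<EE> \<subseteq> angles_in T n \<A> \<and>
     (\<forall>\<alpha>\<in>\<EE>. \<forall>\<beta>\<in>\<EE>. \<forall>\<gamma>. seq_direct_sum T n \<alpha> \<beta> \<gamma> \<longrightarrow> \<gamma> \<in> \<EE>) \<and>
     (\<forall>\<alpha>\<in>angles_in T n \<A>. split_angle T n \<alpha> \<longrightarrow> \<alpha> \<in> \<EE>) \<and>
     (\<forall>\<alpha>\<in>\<EE>. \<forall>f\<in>sub_arr T \<A>. Cod T f = Dom T (\<alpha> ! (n - 1)) \<longrightarrow>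
        (\<forall>\<beta>\<in>Angles T. \<forall>\<phi>.
           Dom T (\<beta> ! 0) = Dom T (\<alpha> ! 0) \<and> \<beta> ! (n - 1) = \<alpha> ! (n - 1) \<cdot>\<^bsub>T\<^esub> f \<and>
           seq_mor T n \<beta> \<alpha> \<phi> \<and> \<phi> ! 0 = Ide T (Dom T (\<alpha> ! 0)) \<and> \<phi> ! (n - 1) = f
           \<longrightarrow> \<beta> \<in> \<EE>)) \<and>
     (\<forall>\<alpha>\<in>\<EE>. \<forall>g\<in>sub_arr T \<A>. Dom T g = Dom T (\<alpha> ! 0) \<longrightarrow>
        (\<forall>\<beta>\<in>Angles T. \<forall>\<phi>.
           Dom T (\<beta> ! 0) = Cod T g \<and> \<beta> ! (n - 1) = SA T g \<cdot>\<^bsub>T\<^esub> \<alpha> ! (n - 1) \<and>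
           seq_mor T n \<alpha> \<beta> \<phi> \<and> \<phi> ! 0 = g \<and> \<phi> ! (n - 1) = Ide T (Dom T (\<alpha> ! (n - 1)))
           \<longrightarrow> \<beta> \<in> \<EE>))"

definition inflations :: "'m list set \<Rightarrow> 'm set" where
  "inflations \<EE> = {\<alpha> ! 0 | \<alpha>. \<alpha> \<in> \<EE>}"

definition deflations :: "nat \<Rightarrow> 'm list set \<Rightarrow> 'm set" where
  "deflations n \<EE> = {\<alpha> ! (n - 2) | \<alpha>. \<alpha> \<in> \<EE>}"

definition phantoms :: "nat \<Rightarrow> 'm list set \<Rightarrow> 'm set" where
  "phantoms n \<EE> = {\<alpha> ! (n - 1) | \<alpha>. \<alpha> \<in> \<EE>}"

definition projective_mor ::
  "('o, 'm, 'x) ang_cat_scheme \<Rightarrow> nat \<Rightarrow> 'o set \<Rightarrow> 'm list set \<Rightarrow> 'm \<Rightarrow> bool" where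
  "projective_mor T n \<A> \<EE> f \<longleftrightarrow> f \<in> sub_arr T \<A> \<and>
     (\<forall>d\<in>deflations n \<EE>. Cod T d = Cod T f \<longrightarrow>
        (\<exists>h\<in>Hom T (Dom T f) (Dom T d). f = d \<cdot>\<^bsub>T\<^esub> h))"

definition injective_mor ::
  "('o, 'm, 'x) ang_cat_scheme \<Rightarrow> 'o set \<Rightarrow> 'm list set \<Rightarrow> 'm \<Rightarrow> bool" where
  "injective_mor T \<A> \<EE> g \<longleftrightarrow> g \<in> sub_arr T \<A> \<and>
     (\<forall>e\<in>inflations \<EE>. Dom T e = Dom T g \<longrightarrow>
        (\<exists>h\<in>Hom T (Cod T e) (Cod T g). g = h \<cdot>\<^bsub>T\<^esub> e))"

definition enough_injective_mors ::
  "('o, 'm, 'x) ang_cat_scheme \<Rightarrow> 'o set \<Rightarrow> 'm list set \<Rightarrow> bool" where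
  "enough_injective_mors T \<A> \<EE> \<longleftrightarrow>
     (\<forall>A\<in>\<A>. \<exists>e\<in>inflations \<EE>. Dom T e = A \<and> injective_mor T \<A> \<EE> e)"

definition enough_projective_mors ::
  "('o, 'm, 'x) ang_cat_scheme \<Rightarrow> nat \<Rightarrow> 'o set \<Rightarrow> 'm list set \<Rightarrow> bool" where
  "enough_projective_mors T n \<A> \<EE> \<longleftrightarrow>
     (\<forall>C\<in>\<A>. \<exists>d\<in>deflations n \<EE>. Cod T d = C \<and> projective_mor T n \<A> \<EE> d)"

definition phantom_ideal :: "('o, 'm, 'x) ang_cat_scheme \<Rightarrow> 'o set \<Rightarrow> 'm set \<Rightarrow> bool" where
  "phantom_ideal T \<A> \<I> \<longleftrightarrow>
     (\<forall>i\<in>\<I>. i \<in> Arr T \<and> Dom T i \<in> \<A> \<and> Cod T i \<in> SO T ` \<A>) \<and>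
     (\<forall>i\<in>\<I>. \<forall>j\<in>\<I>. Dom T i = Dom T j \<and> Cod T i = Cod T j \<longrightarrow> i \<boxplus>\<^bsub>T\<^esub> j \<in> \<I>) \<and>
     (\<forall>i\<in>\<I>. \<forall>f\<in>sub_arr T \<A>. \<forall>g\<in>sub_arr T \<A>.
        Cod T f = Dom T i \<and> Cod T i = SO T (Dom T g) \<longrightarrow> SA T g \<cdot>\<^bsub>T\<^esub> i \<cdot>\<^bsub>T\<^esub> f \<in> \<I>)"

definition precover :: "('o, 'm, 'x) add_cat_scheme \<Rightarrow> 'm set \<Rightarrow> 'o \<Rightarrow> 'm \<Rightarrow> bool" where
  "precover T \<I> B \<phi> \<longleftrightarrow> \<phi> \<in> \<I> \<and> Cod T \<phi> = B \<and>
     (\<forall>\<phi>'\<in>\<I>. Cod T \<phi>' = B \<longrightarrow> (\<exists>h\<in>Hom T (Dom T \<phi>') (Dom T \<phi>). \<phi>' = \<phi> \<cdot>\<^bsub>T\<^esub> h))"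

definition preenvelope :: "('o, 'm, 'x) add_cat_scheme \<Rightarrow> 'm set \<Rightarrow> 'o \<Rightarrow> 'm \<Rightarrow> bool" where
  "preenvelope T \<I> B \<phi> \<longleftrightarrow> \<phi> \<in> \<I> \<and> Dom T \<phi> = B \<and>
     (\<forall>\<phi>'\<in>\<I>. Dom T \<phi>' = B \<longrightarrow> (\<exists>h\<in>Hom T (Cod T \<phi>) (Cod T \<phi>'). \<phi>' = h \<cdot>\<^bsub>T\<^esub> \<phi>))"

definition precovering :: "('o, 'm, 'x) ang_cat_scheme \<Rightarrow> 'o set \<Rightarrow> 'm set \<Rightarrow> bool" where
  "precovering T \<A> \<I> \<longleftrightarrow> (\<forall>A\<in>\<A>. \<exists>\<phi>. precover T \<I> (SO T A) \<phi>)"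

definition preenveloping :: "('o, 'm, 'x) ang_cat_scheme \<Rightarrow> 'o set \<Rightarrow> 'm set \<Rightarrow> bool" where
  "preenveloping T \<A> \<I> \<longleftrightarrow> (\<forall>B\<in>\<A>. \<exists>\<phi>. preenvelope T \<I> B \<phi>)"

end

theory Submission
  imports Defs
begin

text \<open>
  By the rotation axiom, the completion axiom (F3) extends not only a commuting square on the first
  two terms but also one at the last morphism (given \<open>\<phi>\<^sub>1\<close>, \<open>\<phi>\<^sub>n\<close>) and one on the last two terms
  (given \<open>\<phi>\<^bsub>n-1\<^esub>\<close>, \<open>\<phi>\<^sub>n\<close>).  For two \<open>n\<close>-angles with a common end term, a factorization of the
  inflations, of the deflations or of the phantoms is a square on the first two terms, on the last
  two terms or at the last morphism, with an identity on the common term.  Completing it turns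
  factorizations of inflations or deflations into factorizations of phantoms and vice versa.
  Phantoms are stable
  under composition by (N2) and (N3), since the required \<open>n\<close>-angles and morphisms exist by the same
  completions, and \<open>i + j\<close> is the direct sum of \<open>i\<close> and \<open>j\<close> composed with diagonal and codiagonal.
\<close>

lemma HomD:
  assumes "f \<in> Hom T A B"
  shows "f \<in> Arr T" "Dom T f = A" "Cod T f = B"
  using assms by (auto simp: Hom_def)

section \<open>Arithmetic of hom groups and maps between biproducts\<close>

context additive_category
begin

lemma hom_obj:
  assumes "f \<in> Hom T A B"
  shows "A \<in> Obj T" "B \<in> Obj T"
  using dom_in cod_in HomD[OF assms] by auto

lemma hom_group_simps [simp]:
  "carrier (hom_group T A B) = Hom T A B"
  "mult (hom_group T A B) = Add T"
  "one (hom_group T A B) = Zero T A B"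
  by (simp_all add: hom_group_def)

lemma zero_in:
  assumes "A \<in> Obj T" "B \<in> Obj T"
  shows "Zero T A B \<in> Hom T A B"
proof -
  interpret comm_group "hom_group T A B"
    using hom_comm_group assms by blast
  show ?thesis using one_closed by simp
qed

lemma add_in:
  assumes "f \<in> Hom T A B" "g \<in> Hom T A B"
  shows "f \<boxplus> g \<in> Hom T A B"
proof -
  interpret comm_group "hom_group T A B"
    using hom_comm_group hom_obj[OF assms(1)] by blast
  show ?thesis using m_closed[of f g] assms by simp
qed

lemma add_zero:
  assumes "f \<in> Hom T A B"
  shows "f \<boxplus> Zero T A B = f" "Zero T A B \<boxplus> f = f"
proof -
  interpret comm_group "hom_group T A B"
    using hom_comm_group hom_obj[OF assms(1)] by blast
  show "f \<boxplus> Zero T A B = f" "Zero T A B \<boxplus> f = f"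
    using r_one[of f] l_one[of f] assms by simp_all
qed

text \<open>The neutral element is the only idempotent of a group. Additive operations send
  idempotents to idempotents, so this is how composition on either side, and later
  \<open>SA\<close>, is seen to preserve zero morphisms.\<close>

lemma add_idem_zero:
  assumes "f \<in> Hom T A B" "f \<boxplus> f = f"
  shows "f = Zero T A B"
proof -
  interpret comm_group "hom_group T A B"
    using hom_comm_group hom_obj[OF assms(1)] by blast
  show ?thesis using r_cancel_one[of f f] assms by simp
qed

lemma Neg_in:
  assumes "f \<in> Hom T A B"
  shows "Neg T f \<in> Hom T A B"
proof -
  interpret comm_group "hom_group T A B"
    using hom_comm_group hom_obj[OF assms(1)] by blast
  show ?thesis using inv_closed[of f] assms HomD[OF assms] by (simp add: Neg_def)
qed

lemma Neg_add:
  assumes "f \<in> Hom T A B"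
  shows "Neg T f \<boxplus> f = Zero T A B"
proof -
  interpret comm_group "hom_group T A B"
    using hom_comm_group hom_obj[OF assms(1)] by blast
  show ?thesis using l_inv[of f] assms HomD[OF assms] by (simp add: Neg_def)
qed

lemma Neg_Neg:
  assumes "f \<in> Hom T A B"
  shows "Neg T (Neg T f) = f"
proof -
  interpret comm_group "hom_group T A B"
    using hom_comm_group hom_obj[OF assms(1)] by blast
  show ?thesis using inv_inv[of f] assms HomD[OF assms] HomD[OF Neg_in[OF assms]]
    by (simp add: Neg_def)
qed

text \<open>Uniqueness of inverses plays the same part for signs: an additive operation applied to
  \<open>Neg T f\<close> is a left inverse of its value at \<open>f\<close>.\<close>

lemma Neg_unique:
  assumes "f \<in> Hom T A B" "g \<in> Hom T A B" "g \<boxplus> f = Zero T A B"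
  shows "Neg T f = g"
proof -
  interpret comm_group "hom_group T A B"
    using hom_comm_group hom_obj[OF assms(1)] by blast
  show ?thesis using inv_equality[of g f] assms HomD[OF assms(1)] by (simp add: Neg_def)
qed

lemma comp_zero:
  assumes "g \<in> Hom T B C" "A \<in> Obj T"
  shows "g \<cdot> Zero T A B = Zero T A C"
proof -
  have z: "Zero T A B \<in> Hom T A B"
    using zero_in hom_obj[OF assms(1)] assms by auto
  show ?thesis
    using add_idem_zero[OF comp_in[OF z assms(1)]] comp_add[OF z z assms(1)] add_zero[OF z] by simp
qed

lemma zero_comp:
  assumes "f \<in> Hom T A B" "C \<in> Obj T"
  shows "Zero T B C \<cdot> f = Zero T A C"
proof -
  have z: "Zero T B C \<in> Hom T B C"
    using zero_in hom_obj[OF assms(1)] assms by auto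
  show ?thesis
    using add_idem_zero[OF comp_in[OF assms(1) z]] add_comp[OF assms(1) z z] add_zero[OF z] by simp
qed

lemma comp_Neg:
  assumes "f \<in> Hom T A B" "g \<in> Hom T B C"
  shows "g \<cdot> Neg T f = Neg T (g \<cdot> f)"
  using Neg_unique[OF comp_in[OF assms] comp_in[OF Neg_in[OF assms(1)] assms(2)]]
    comp_add[OF Neg_in[OF assms(1)] assms] Neg_add[OF assms(1)]
    comp_zero[OF assms(2)] hom_obj(1)[OF assms(1)] by simp

lemma Neg_comp:
  assumes "f \<in> Hom T A B" "g \<in> Hom T B C"
  shows "Neg T g \<cdot> f = Neg T (g \<cdot> f)"
  using Neg_unique[OF comp_in[OF assms] comp_in[OF assms(1) Neg_in[OF assms(2)]]]
    add_comp[OF assms(1) Neg_in[OF assms(2)] assms(2)] Neg_add[OF assms(2)]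
    zero_comp[OF assms(1)] hom_obj(2)[OF assms(2)] by simp

text \<open>\<open>m\<close> is the diagonal map with entries \<open>a\<close> and \<open>b\<close>.
  The four equations are the squares that make the injections and projections morphisms of sequences
  when direct sums are formed termwise.\<close>

lemma biproduct_map:
  assumes S: "biproduct T A B S i1 i2 p1 p2" and S': "biproduct T A' B' S' j1 j2 q1 q2"
    and a: "a \<in> Hom T A A'" and b: "b \<in> Hom T B B'"
  defines "m \<equiv> (j1 \<cdot> a \<cdot> p1) \<boxplus> (j2 \<cdot> b \<cdot> p2)"
  shows "m \<in> Hom T S S'" "m \<cdot> i1 = j1 \<cdot> a" "m \<cdot> i2 = j2 \<cdot> b" "q1 \<cdot> m = a \<cdot> p1" "q2 \<cdot> m = b \<cdot> p2"
proof -
  note s = S[unfolded biproduct_def] and s' = S'[unfolded biproduct_def]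
  have i: "i1 \<in> Hom T A S" "i2 \<in> Hom T B S" "p1 \<in> Hom T S A" "p2 \<in> Hom T S B"
    "j1 \<in> Hom T A' S'" "j2 \<in> Hom T B' S'" "q1 \<in> Hom T S' A'" "q2 \<in> Hom T S' B'"
    using s s' by auto
  have o: "A \<in> Obj T" "B \<in> Obj T" "S \<in> Obj T" "A' \<in> Obj T" "B' \<in> Obj T" "S' \<in> Obj T"
    using s s' by auto
  have ap: "a \<cdot> p1 \<in> Hom T S A'" and bp: "b \<cdot> p2 \<in> Hom T S B'"
    using comp_in i a b by blast+
  have ja: "j1 \<cdot> a \<in> Hom T A S'" and jb: "j2 \<cdot> b \<in> Hom T B S'"
    using comp_in i a b by blast+
  have l: "j1 \<cdot> a \<cdot> p1 \<in> Hom T S S'" and r: "j2 \<cdot> b \<cdot> p2 \<in> Hom T S S'"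
    using comp_in i ap bp by blast+
  show "m \<in> Hom T S S'"
    unfolding m_def using add_in l r by blast
  \<comment> \<open>The summand through \<open>p2\<close> vanishes on \<open>i1\<close> because
    \<open>p2 \<cdot> i1\<close> is zero. The other three computations use the remaining
    orthogonality relations in the same way.\<close>
  have "(j1 \<cdot> a \<cdot> p1) \<cdot> i1 = j1 \<cdot> a" "(j2 \<cdot> b \<cdot> p2) \<cdot> i1 = Zero T A S'"
    using comp_assoc[OF i(1) ap i(5)] comp_assoc[OF i(1) i(3) a] comp_ide[OF a]
      comp_assoc[OF i(1) bp i(6)] comp_assoc[OF i(1) i(4) b] comp_zero[OF b o(1)]
      comp_zero[OF i(6) o(1)] s by simp_all
  then show "m \<cdot> i1 = j1 \<cdot> a"
    unfolding m_def using add_comp[OF i(1) l r] add_zero[OF ja] by simp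
  have "(j1 \<cdot> a \<cdot> p1) \<cdot> i2 = Zero T B S'" "(j2 \<cdot> b \<cdot> p2) \<cdot> i2 = j2 \<cdot> b"
    using comp_assoc[OF i(2) ap i(5)] comp_assoc[OF i(2) i(3) a] comp_ide[OF b]
      comp_assoc[OF i(2) bp i(6)] comp_assoc[OF i(2) i(4) b] comp_zero[OF a o(2)]
      comp_zero[OF i(5) o(2)] s by simp_all
  then show "m \<cdot> i2 = j2 \<cdot> b"
    unfolding m_def using add_comp[OF i(2) l r] add_zero[OF jb] by simp
  have "q1 \<cdot> j1 \<cdot> a \<cdot> p1 = a \<cdot> p1" "q1 \<cdot> j2 \<cdot> b \<cdot> p2 = Zero T S A'"
    using comp_assoc[OF ap i(5) i(7)] ide_comp[OF ap]
      comp_assoc[OF bp i(6) i(7)] zero_comp[OF bp o(4)] s' by simp_all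
  then show "q1 \<cdot> m = a \<cdot> p1"
    unfolding m_def using comp_add[OF l r i(7)] add_zero[OF ap] by simp
  have "q2 \<cdot> j1 \<cdot> a \<cdot> p1 = Zero T S B'" "q2 \<cdot> j2 \<cdot> b \<cdot> p2 = b \<cdot> p2"
    using comp_assoc[OF ap i(5) i(8)] zero_comp[OF ap o(5)]
      comp_assoc[OF bp i(6) i(8)] ide_comp[OF bp] s' by simp_all
  then show "q2 \<cdot> m = b \<cdot> p2"
    unfolding m_def using comp_add[OF l r i(8)] add_zero[OF bp] by simp
qed

end

section \<open>The automorphism as an additive, full and faithful functor\<close>

context n_angulated_category
begin

lemmas SO_bij = automorphism[unfolded automorphism_def, THEN conjunct1]

lemmas SA_bij = automorphism[unfolded automorphism_def, THEN conjunct2, THEN conjunct1]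

lemma SA_functor:
  "f \<in> Arr T \<Longrightarrow> Dom T (SA T f) = SO T (Dom T f)"
  "f \<in> Arr T \<Longrightarrow> Cod T (SA T f) = SO T (Cod T f)"
  "A \<in> Obj T \<Longrightarrow> SA T (Ide T A) = Ide T (SO T A)"
  "f \<in> Arr T \<Longrightarrow> g \<in> Arr T \<Longrightarrow> Cod T f = Dom T g \<Longrightarrow> SA T (g \<cdot> f) = SA T g \<cdot> SA T f"
  "f \<in> Arr T \<Longrightarrow> g \<in> Arr T \<Longrightarrow> Dom T f = Dom T g \<Longrightarrow> Cod T f = Cod T g \<Longrightarrow>
    SA T (f \<boxplus> g) = SA T f \<boxplus> SA T g"
  using automorphism[unfolded automorphism_def, THEN conjunct2, THEN conjunct2] by blast+

lemma SO_in: "A \<in> Obj T \<Longrightarrow> SO T A \<in> Obj T"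
  by (rule bij_betwE[OF SO_bij, rule_format])

lemma SO_inj: "A \<in> Obj T \<Longrightarrow> B \<in> Obj T \<Longrightarrow> SO T A = SO T B \<Longrightarrow> A = B"
  by (rule inj_onD[OF bij_betw_imp_inj_on[OF SO_bij]])

lemma SO_surj:
  assumes "B \<in> Obj T"
  shows "\<exists>A\<in>Obj T. SO T A = B"
proof -
  have "B \<in> SO T ` Obj T" using assms bij_betw_imp_surj_on[OF SO_bij] by simp
  then show ?thesis by (auto simp: image_iff)
qed

lemma SA_in:
  assumes "f \<in> Hom T A B"
  shows "SA T f \<in> Hom T (SO T A) (SO T B)"
  using bij_betwE[OF SA_bij, rule_format, OF HomD(1)[OF assms]]
    SA_functor(1,2)[OF HomD(1)[OF assms]] HomD(2,3)[OF assms]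
  by (simp add: Hom_def)

lemma SA_comp:
  assumes "f \<in> Hom T A B" "g \<in> Hom T B C"
  shows "SA T (g \<cdot> f) = SA T g \<cdot> SA T f"
  using SA_functor(4)[OF HomD(1)[OF assms(1)] HomD(1)[OF assms(2)]] HomD[OF assms(1)] HomD[OF assms(2)]
  by simp

lemma SA_add:
  assumes "f \<in> Hom T A B" "g \<in> Hom T A B"
  shows "SA T (f \<boxplus> g) = SA T f \<boxplus> SA T g"
  using SA_functor(5)[OF HomD(1)[OF assms(1)] HomD(1)[OF assms(2)]] HomD[OF assms(1)] HomD[OF assms(2)]
  by simp

lemmas SA_ide = SA_functor(3)

lemma SA_inj: "f \<in> Hom T A B \<Longrightarrow> g \<in> Hom T C D \<Longrightarrow> SA T f = SA T g \<Longrightarrow> f = g"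
  by (rule inj_onD[OF bij_betw_imp_inj_on[OF SA_bij] _ HomD(1) HomD(1)])

text \<open>Fullness: bijectivity on morphisms gives a preimage, and injectivity on objects
  identifies its domain and codomain.\<close>

lemma SA_surj:
  assumes "h \<in> Hom T (SO T A) (SO T B)" "A \<in> Obj T" "B \<in> Obj T"
  obtains g where "g \<in> Hom T A B" "SA T g = h"
proof -
  have "h \<in> SA T ` Arr T"
    using HomD(1)[OF assms(1)] bij_betw_imp_surj_on[OF SA_bij] by simp
  then obtain g where g: "g \<in> Arr T" "SA T g = h"
    by (rule imageE) simp
  have "SA T g \<in> Hom T (SO T (Dom T g)) (SO T (Cod T g))"
    using SA_in[of g] g(1) by (simp add: Hom_def)
  then have "SO T (Dom T g) = SO T A" "SO T (Cod T g) = SO T B"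
    using g(2) assms(1) by (simp_all add: Hom_def)
  then have "Dom T g = A" "Cod T g = B"
    using SO_inj dom_in[OF g(1)] cod_in[OF g(1)] assms(2,3) by blast+
  then show thesis using g that by (simp add: Hom_def)
qed

lemma SA_zero:
  assumes "A \<in> Obj T" "B \<in> Obj T"
  shows "SA T (Zero T A B) = Zero T (SO T A) (SO T B)"
  using add_idem_zero[OF SA_in[OF zero_in[OF assms]]] add_zero[OF zero_in[OF assms]]
    SA_add[OF zero_in[OF assms] zero_in[OF assms]] by simp

lemma SA_Neg:
  assumes "f \<in> Hom T A B"
  shows "SA T (Neg T f) = Neg T (SA T f)"
  using Neg_unique[OF SA_in[OF assms] SA_in[OF Neg_in[OF assms]]] Neg_add[OF assms]
    SA_add[OF Neg_in[OF assms] assms] SA_zero hom_obj[OF assms] by simp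

text \<open>The factor (-1)^n of the rotation axiom. It is an involution that passes through
  compositions and \<open>SA\<close>, so rotations are handled below without splitting on the parity
  of \<open>n\<close>.\<close>

definition rot_sign where
  "rot_sign f = (if even n then f else Neg T f)"

lemma rot_sign_in: "f \<in> Hom T A B \<Longrightarrow> rot_sign f \<in> Hom T A B"
  unfolding rot_sign_def using Neg_in[of f A B] by simp

lemma rot_sign_rot_sign: "f \<in> Hom T A B \<Longrightarrow> rot_sign (rot_sign f) = f"
  unfolding rot_sign_def using Neg_Neg[of f A B] by simp

lemma rot_sign_inj:
  assumes "f \<in> Hom T A B" "g \<in> Hom T C D" "rot_sign f = rot_sign g"
  shows "f = g"
  using arg_cong[OF assms(3), of rot_sign]
  unfolding rot_sign_rot_sign[OF assms(1)] rot_sign_rot_sign[OF assms(2)] .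

lemma comp_rot_sign:
  "f \<in> Hom T A B \<Longrightarrow> g \<in> Hom T B C \<Longrightarrow> g \<cdot> rot_sign f = rot_sign (g \<cdot> f)"
  unfolding rot_sign_def using comp_Neg[of f A B g C] by simp

lemma rot_sign_comp:
  "f \<in> Hom T A B \<Longrightarrow> g \<in> Hom T B C \<Longrightarrow> rot_sign g \<cdot> f = rot_sign (g \<cdot> f)"
  unfolding rot_sign_def using Neg_comp[of f A B g C] by simp

lemma SA_rot_sign: "f \<in> Hom T A B \<Longrightarrow> SA T (rot_sign f) = rot_sign (SA T f)"
  unfolding rot_sign_def using SA_Neg[of f A B] by simp

lemma left_rotation_rot_sign: "left_rotation T n \<alpha> = tl \<alpha> @ [rot_sign (SA T (hd \<alpha>))]"
  by (simp add: left_rotation_def rot_sign_def)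

section \<open>Sequences as lists, and right rotation\<close>

lemma sigma_seq_hom:
  assumes "sigma_seq T n \<alpha>"
  shows "length \<alpha> = n"
    and "Suc k < n \<Longrightarrow> \<alpha> ! k \<in> Hom T (Dom T (\<alpha> ! k)) (Dom T (\<alpha> ! Suc k))"
    and "\<alpha> ! (n - 1) \<in> Hom T (Dom T (\<alpha> ! (n - 1))) (SO T (Dom T (\<alpha> ! 0)))"
    and "k < n \<Longrightarrow> Dom T (\<alpha> ! k) \<in> Obj T"
proof -
  note s = assms[unfolded sigma_seq_def]
  show l: "length \<alpha> = n" using s by simp
  have arr: "\<alpha> ! i \<in> Arr T" if "i < n" for i
    using subsetD[OF s[THEN conjunct2, THEN conjunct1] nth_mem] that l by simp
  show "\<alpha> ! k \<in> Hom T (Dom T (\<alpha> ! k)) (Dom T (\<alpha> ! Suc k))" if "Suc k < n"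
    using s arr[of k] that by (simp add: Hom_def)
  show "\<alpha> ! (n - 1) \<in> Hom T (Dom T (\<alpha> ! (n - 1))) (SO T (Dom T (\<alpha> ! 0)))"
    using s arr[of "n - 1"] n_ge_3 by (simp add: Hom_def)
  show "Dom T (\<alpha> ! k) \<in> Obj T" if "k < n"
    using dom_in[OF arr[OF that]] .
qed

text \<open>A sequence stores its objects only as domains. Prescribing them by \<open>D\<close>
  reduces the check to hom membership, and the second conclusion recovers them.\<close>

lemma sigma_seqI:
  assumes "length \<alpha> = n" "\<And>k. Suc k < n \<Longrightarrow> \<alpha> ! k \<in> Hom T (D k) (D (Suc k))"
    and "\<alpha> ! (n - 1) \<in> Hom T (D (n - 1)) (SO T (D 0))"
  shows "sigma_seq T n \<alpha>" "k < n \<Longrightarrow> Dom T (\<alpha> ! k) = D k"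
proof -
  have *: "\<alpha> ! k \<in> Arr T \<and> Dom T (\<alpha> ! k) = D k" if "k < n" for k
    using assms(2)[of k] assms(3) that by (cases "Suc k < n") (auto simp: Hom_def dest!: less_antisym)
  then show "k < n \<Longrightarrow> Dom T (\<alpha> ! k) = D k" by blast
  have "Cod T (\<alpha> ! (n - 1)) = SO T (Dom T (\<alpha> ! 0))"
    using assms(3) * n_ge_3 by (auto simp: Hom_def)
  moreover have "Cod T (\<alpha> ! k) = Dom T (\<alpha> ! Suc k)" if "Suc k < n" for k
    using assms(2)[of k] * that by (auto simp: Hom_def)
  ultimately show "sigma_seq T n \<alpha>"
    using * assms(1) unfolding sigma_seq_def by (auto simp: in_set_conv_nth)
qed

text \<open>\<open>a\<close> is the desuspension of the last morphism of \<open>\<alpha>\<close>.\<close>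

definition right_rotation where
  "right_rotation a \<alpha> = rot_sign a # butlast \<alpha>"

text \<open>The automorphism is bijective on objects and on morphisms, so the last morphism is
  literally a value of \<open>SA\<close>, not merely isomorphic to one. This makes right rotation
  available.\<close>

lemma last_desuspension:
  assumes "sigma_seq T n \<alpha>"
  obtains X a where "X \<in> Obj T" "SO T X = Dom T (\<alpha> ! (n - 1))"
    "a \<in> Hom T X (Dom T (\<alpha> ! 0))" "SA T a = \<alpha> ! (n - 1)"
proof -
  obtain X where X: "X \<in> Obj T" "SO T X = Dom T (\<alpha> ! (n - 1))"
    using SO_surj sigma_seq_hom(4)[OF assms, of "n - 1"] n_ge_3 by auto
  then show thesis
    using SA_surj[of "\<alpha> ! (n - 1)" X "Dom T (\<alpha> ! 0)"] sigma_seq_hom(3,4)[OF assms] n_ge_3 that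
    by (metis less_le_trans zero_less_numeral)
qed

lemma right_rotation_nth:
  assumes "length \<alpha> = n"
  shows "right_rotation a \<alpha> ! 0 = rot_sign a"
    and "Suc k < n \<Longrightarrow> right_rotation a \<alpha> ! Suc k = \<alpha> ! k"
    and "right_rotation a \<alpha> ! (n - 1) = \<alpha> ! (n - 2)"
    and "length (right_rotation a \<alpha>) = n"
proof -
  show *: "Suc k < n \<Longrightarrow> right_rotation a \<alpha> ! Suc k = \<alpha> ! k" for k
    using assms by (simp add: right_rotation_def nth_butlast)
  have "n - 1 = Suc (n - 2)" using n_ge_3 by simp
  then show "right_rotation a \<alpha> ! (n - 1) = \<alpha> ! (n - 2)"
    using *[of "n - 2"] n_ge_3 by simp
qed (use assms n_ge_3 in \<open>auto simp: right_rotation_def\<close>)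

text \<open>Left rotation undoes right rotation, because the sign is applied twice and cancels. The
  rotation axiom is then read from right to left.\<close>

lemma right_rotation_angle:
  assumes "\<alpha> \<in> Angles T" "a \<in> Hom T X (Dom T (\<alpha> ! 0))" "SA T a = \<alpha> ! (n - 1)"
  shows "right_rotation a \<alpha> \<in> Angles T"
proof -
  note s = angles_seq[OF assms(1)]
  note h = sigma_seq_hom[OF s]
  note rr = right_rotation_nth[OF h(1), where a=a]
  have sx: "SO T X = Dom T (\<alpha> ! (n - 1))"
    using SA_in[OF assms(2)] h(3) assms(3) by (metis HomD(2))
  \<comment> \<open>The objects move one place to the right, with the desuspension \<open>X\<close>
    of the last object of \<alpha> in front.\<close>
  define D where "D k = (case k of 0 \<Rightarrow> X | Suc j \<Rightarrow> Dom T (\<alpha> ! j))" for k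
  have "right_rotation a \<alpha> ! k \<in> Hom T (D k) (D (Suc k))" if "Suc k < n" for k
    using that rr(1) rr(2)[of "k - 1"] h(2)[of "k - 1"] rot_sign_in[OF assms(2)]
    by (cases k) (auto simp: D_def)
  moreover have "right_rotation a \<alpha> ! (n - 1) \<in> Hom T (D (n - 1)) (SO T (D 0))"
  proof -
    \<comment> \<open>Writing \<open>n - 1\<close> as a successor lets the case distinction in
      \<open>D\<close> evaluate to the domain of \<open>\<alpha> ! m\<close>, where \<open>m\<close>
      is \<open>n - 2\<close>.\<close>
    obtain m where m: "n = Suc (Suc m)"
      using n_ge_3 by (metis le_Suc_ex numeral_3_eq_3 add_Suc)
    show ?thesis using rr(3) h(2)[of m] sx m by (simp add: D_def)
  qed
  ultimately have "sigma_seq T n (right_rotation a \<alpha>)"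
    using sigma_seqI(1) rr(4) by blast
  moreover have "left_rotation T n (right_rotation a \<alpha>) = \<alpha>"
  proof -
    have "\<alpha> \<noteq> []" using h(1) n_ge_3 by auto
    then have "last \<alpha> = rot_sign (SA T (rot_sign a))"
      using SA_rot_sign[OF assms(2)] rot_sign_rot_sign[OF SA_in[OF assms(2)]] assms(3) h(1)
      by (simp add: last_conv_nth)
    then show ?thesis
      using append_butlast_last_id[OF \<open>\<alpha> \<noteq> []\<close>]
      by (simp add: left_rotation_rot_sign right_rotation_def)
  qed
  ultimately show ?thesis using F2 assms(1) by simp
qed

section \<open>Completing squares at other positions, and prescribed last morphisms\<close>

text \<open>After a right rotation of both \<open>n\<close>-angles, the desuspended closing square
  becomes the first square. (F3) completes it, and the resulting morphism is rotated back.\<close>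

lemma F3_last:
  assumes A: "\<alpha> \<in> Angles T" and B: "\<beta> \<in> Angles T"
    and f: "f \<in> Hom T (Dom T (\<alpha> ! 0)) (Dom T (\<beta> ! 0))"
    and h: "h \<in> Hom T (Dom T (\<alpha> ! (n - 1))) (Dom T (\<beta> ! (n - 1)))"
    and comm: "SA T f \<cdot> \<alpha> ! (n - 1) = \<beta> ! (n - 1) \<cdot> h"
  shows "\<exists>\<phi>. seq_mor T n \<alpha> \<beta> \<phi> \<and> \<phi> ! 0 = f \<and> \<phi> ! (n - 1) = h"
proof -
  note sa = angles_seq[OF A] and sb = angles_seq[OF B]
  note ha = sigma_seq_hom[OF sa] and hb = sigma_seq_hom[OF sb]
  obtain X a where a: "X \<in> Obj T" "SO T X = Dom T (\<alpha> ! (n - 1))"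
    "a \<in> Hom T X (Dom T (\<alpha> ! 0))" "SA T a = \<alpha> ! (n - 1)"
    using last_desuspension[OF sa] .
  obtain Y b where b: "Y \<in> Obj T" "SO T Y = Dom T (\<beta> ! (n - 1))"
    "b \<in> Hom T Y (Dom T (\<beta> ! 0))" "SA T b = \<beta> ! (n - 1)"
    using last_desuspension[OF sb] .
  obtain k where k: "k \<in> Hom T X Y" "SA T k = h"
    using SA_surj[of h X Y] h a b by auto
  \<comment> \<open>Faithfulness of \<open>SA\<close> desuspends the given square.\<close>
  have fakb: "f \<cdot> a = b \<cdot> k"
    using SA_inj[OF comp_in[OF a(3) f] comp_in[OF k(1) b(3)]]
      SA_comp[OF a(3) f] SA_comp[OF k(1) b(3)] comm a b k by simp
  let ?\<alpha> = "right_rotation a \<alpha>" and ?\<beta> = "right_rotation b \<beta>"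
  note ra = right_rotation_nth[OF ha(1), where a=a] and rb = right_rotation_nth[OF hb(1), where a=b]
  have D: "Dom T (?\<alpha> ! 0) = X" "Dom T (?\<beta> ! 0) = Y"
    using ra(1) rb(1) rot_sign_in[OF a(3)] rot_sign_in[OF b(3)] by (auto simp: Hom_def)
  have r1: "?\<alpha> ! 1 = \<alpha> ! 0" "?\<beta> ! 1 = \<beta> ! 0"
    using ra(2)[of 0] rb(2)[of 0] n_ge_3 by auto
  \<comment> \<open>Both rotations carry the same sign, so the square still commutes, with
    \<open>k\<close> as first and \<open>f\<close> as second component.\<close>
  have "f \<cdot> ?\<alpha> ! 0 = ?\<beta> ! 0 \<cdot> k"
    using fakb ra(1) rb(1) comp_rot_sign[OF a(3) f] rot_sign_comp[OF k(1) b(3)] by simp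
  then obtain \<psi> where \<psi>: "seq_mor T n ?\<alpha> ?\<beta> \<psi>" "\<psi> ! 0 = k" "\<psi> ! 1 = f"
    using F3[OF right_rotation_angle[OF A a(3,4)] right_rotation_angle[OF B b(3,4)], of k f]
      k(1) f D r1 by auto
  \<comment> \<open>Rotating back moves the components one place to the left; the first component
    \<open>k\<close> of \<psi> returns at the end, suspended to \<open>h\<close>.\<close>
  let ?\<phi> = "tl \<psi> @ [h]"
  have l: "length \<psi> = n" using \<psi>(1) by (simp add: seq_mor_def)
  have p: "?\<phi> ! i = \<psi> ! Suc i" if "Suc i < n" for i
  proof -
    have "i < n - 1" using that by simp
    then show ?thesis using l by (simp add: nth_append nth_tl)
  qed
  have pl: "?\<phi> ! (n - 1) = h"
    using l by (simp add: nth_append)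
  have comp: "?\<phi> ! i \<in> Hom T (Dom T (\<alpha> ! i)) (Dom T (\<beta> ! i))" if "i < n" for i
  proof (cases "Suc i < n")
    case True
    then show ?thesis using \<psi>(1) p[OF True] ra(2)[OF True] rb(2)[OF True]
      unfolding seq_mor_def by metis
  next
    case False
    then have "i = n - 1" using that by simp
    then show ?thesis using pl h by simp
  qed
  have sq: "?\<phi> ! Suc i \<cdot> \<alpha> ! i = \<beta> ! i \<cdot> ?\<phi> ! i" if "Suc i < n" for i
  proof (cases "Suc (Suc i) < n")
    case True
    then show ?thesis using \<psi>(1) p[OF True] p[OF that] ra(2)[OF that] rb(2)[OF that]
      unfolding seq_mor_def by metis
  next
    case False
    then have i: "Suc i = n - 1" "i = n - 2" using that by auto
    \<comment> \<open>The remaining square, at index \<open>n - 2\<close>, is the closing square of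
      \<psi>.\<close>
    have "SA T (\<psi> ! 0) \<cdot> ?\<alpha> ! (n - 1) = ?\<beta> ! (n - 1) \<cdot> \<psi> ! (n - 1)"
      using \<psi>(1) by (simp add: seq_mor_def)
    then show ?thesis using p[OF that] pl i \<psi>(2) k(2) ra(3) rb(3) by simp
  qed
  have "?\<phi> ! 0 = f" using p[of 0] \<psi>(3) n_ge_3 by simp
  then have "seq_mor T n \<alpha> \<beta> ?\<phi> \<and> ?\<phi> ! 0 = f \<and> ?\<phi> ! (n - 1) = h"
    unfolding seq_mor_def using sa sb l n_ge_3 comp sq pl comm by simp
  then show ?thesis by blast
qed

text \<open>One right rotation turns a square on the last two terms into a closing square, which
  \<open>F3_last\<close> completes. The first square of the completion, suspended, gives the claim
  for its second component.\<close>

lemma F3_last_two: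
  assumes A: "\<alpha> \<in> Angles T" and B: "\<beta> \<in> Angles T"
    and g: "g \<in> Hom T (Dom T (\<alpha> ! (n - 2))) (Dom T (\<beta> ! (n - 2)))"
    and h: "h \<in> Hom T (Dom T (\<alpha> ! (n - 1))) (Dom T (\<beta> ! (n - 1)))"
    and comm: "h \<cdot> \<alpha> ! (n - 2) = \<beta> ! (n - 2) \<cdot> g"
  shows "\<exists>f \<in> Hom T (Dom T (\<alpha> ! 0)) (Dom T (\<beta> ! 0)).
           SA T f \<cdot> \<alpha> ! (n - 1) = \<beta> ! (n - 1) \<cdot> h"
proof -
  note sa = angles_seq[OF A] and sb = angles_seq[OF B]
  note ha = sigma_seq_hom[OF sa] and hb = sigma_seq_hom[OF sb]
  obtain X a where a: "X \<in> Obj T" "SO T X = Dom T (\<alpha> ! (n - 1))"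
    "a \<in> Hom T X (Dom T (\<alpha> ! 0))" "SA T a = \<alpha> ! (n - 1)"
    using last_desuspension[OF sa] .
  obtain Y b where b: "Y \<in> Obj T" "SO T Y = Dom T (\<beta> ! (n - 1))"
    "b \<in> Hom T Y (Dom T (\<beta> ! 0))" "SA T b = \<beta> ! (n - 1)"
    using last_desuspension[OF sb] .
  obtain k where k: "k \<in> Hom T X Y" "SA T k = h"
    using SA_surj[of h X Y] h a b by auto
  let ?\<alpha> = "right_rotation a \<alpha>" and ?\<beta> = "right_rotation b \<beta>"
  note ra = right_rotation_nth[OF ha(1), where a=a] and rb = right_rotation_nth[OF hb(1), where a=b]
  have D: "Dom T (?\<alpha> ! 0) = X" "Dom T (?\<beta> ! 0) = Y"
    using ra(1) rb(1) rot_sign_in[OF a(3)] rot_sign_in[OF b(3)] by (auto simp: Hom_def)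
  obtain \<psi> where \<psi>: "seq_mor T n ?\<alpha> ?\<beta> \<psi>" "\<psi> ! 0 = k"
    using F3_last[OF right_rotation_angle[OF A a(3,4)] right_rotation_angle[OF B b(3,4)], of k g]
      k g D ra(3) rb(3) comm by auto
  have f: "\<psi> ! 1 \<in> Hom T (Dom T (\<alpha> ! 0)) (Dom T (\<beta> ! 0))"
  proof -
    have "\<psi> ! 1 \<in> Hom T (Dom T (?\<alpha> ! 1)) (Dom T (?\<beta> ! 1))"
      using \<psi>(1) n_ge_3 by (simp add: seq_mor_def)
    then show ?thesis using ra(2)[of 0] rb(2)[of 0] n_ge_3 by simp
  qed
  have "\<psi> ! Suc 0 \<cdot> ?\<alpha> ! 0 = ?\<beta> ! 0 \<cdot> \<psi> ! 0"
    using \<psi>(1) n_ge_3 by (simp add: seq_mor_def)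
  \<comment> \<open>The sign is pulled out of both sides of the first square so that it can be
    cancelled.\<close>
  then have "rot_sign (\<psi> ! 1 \<cdot> a) = rot_sign (b \<cdot> k)"
    using ra(1) rb(1) \<psi>(2) comp_rot_sign[OF a(3) f] rot_sign_comp[OF k(1) b(3)] by simp
  then have "\<psi> ! 1 \<cdot> a = b \<cdot> k"
    using rot_sign_inj comp_in[OF a(3) f] comp_in[OF k(1) b(3)] by blast
  then have "SA T (\<psi> ! 1) \<cdot> \<alpha> ! (n - 1) = \<beta> ! (n - 1) \<cdot> h"
    using SA_comp[OF a(3) f] SA_comp[OF k(1) b(3)] a b k by simp
  then show ?thesis using f by blast
qed

text \<open>The signed desuspension of \<open>f\<close> is the first morphism of some
  \<open>n\<close>-angle by (F1). Left rotation makes its target \<open>A\<close> the first object,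
  and the second sign cancels, leaving \<open>f\<close> as last morphism.\<close>

lemma angle_with_last:
  assumes f: "f \<in> Hom T B (SO T A)" and A: "A \<in> Obj T"
  shows "\<exists>\<alpha>\<in>Angles T. Dom T (\<alpha> ! 0) = A \<and> \<alpha> ! (n - 1) = f"
proof -
  obtain X where X: "X \<in> Obj T" "SO T X = B"
    using SO_surj hom_obj(1)[OF f] by auto
  obtain a where a: "a \<in> Hom T X A" "SA T a = f"
    using SA_surj[of f X A] f X A by auto
  obtain \<beta> where \<beta>: "\<beta> \<in> Angles T" "\<beta> ! 0 = rot_sign a"
    using F1_first HomD(1)[OF rot_sign_in[OF a(1)]] by blast
  note s = angles_seq[OF \<beta>(1)]
  note h = sigma_seq_hom[OF s]
  let ?\<alpha> = "left_rotation T n \<beta>"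
  have hd: "hd \<beta> = rot_sign a"
    using \<beta>(2) h(1) n_ge_3 by (cases \<beta>) auto
  have sg: "rot_sign (SA T (rot_sign a)) = f"
    using SA_rot_sign[OF a(1)] rot_sign_rot_sign[OF SA_in[OF a(1)]] a(2) by simp
  have lr: "?\<alpha> = tl \<beta> @ [f]"
    using hd sg by (simp add: left_rotation_rot_sign)
  have "?\<alpha> ! 0 = \<beta> ! 1" "?\<alpha> ! (n - 1) = f"
    using h(1) n_ge_3 by (simp_all add: lr nth_append nth_tl)
  moreover have "Dom T (\<beta> ! 1) = A"
    using h(2)[of 0] n_ge_3 \<beta>(2) HomD(3)[OF rot_sign_in[OF a(1)]] HomD(3)[OF h(2)[of 0]] by auto
  moreover have "?\<alpha> \<in> Angles T" using F2[OF s] \<beta>(1) by simp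
  ultimately show ?thesis by (intro bexI[of _ ?\<alpha>]) simp_all
qed

section \<open>Direct sums of sequences\<close>

lemma SA_biproduct:
  assumes "biproduct T A B S i1 i2 p1 p2"
  shows "biproduct T (SO T A) (SO T B) (SO T S) (SA T i1) (SA T i2) (SA T p1) (SA T p2)"
proof -
  note s = assms[unfolded biproduct_def]
  have i: "i1 \<in> Hom T A S" "i2 \<in> Hom T B S" "p1 \<in> Hom T S A" "p2 \<in> Hom T S B"
    using s by auto
  show ?thesis
    unfolding biproduct_def
    using s SA_in[OF i(1)] SA_in[OF i(2)] SA_in[OF i(3)] SA_in[OF i(4)]
      SA_comp[OF i(1) i(3)] SA_comp[OF i(2) i(4)] SA_comp[OF i(2) i(3)] SA_comp[OF i(1) i(4)]
      SA_comp[OF i(3) i(1)] SA_comp[OF i(4) i(2)]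
      SA_add[OF comp_in[OF i(3) i(1)] comp_in[OF i(4) i(2)]]
    by (simp add: SO_in SA_ide SA_zero)
qed

text \<open>Closure under direct sums speaks of any given biproduct of sequences; this termwise
  construction supplies one.\<close>

lemma seq_direct_sum_exists:
  assumes a: "sigma_seq T n \<alpha>" and b: "sigma_seq T n \<beta>"
  shows "\<exists>\<gamma>. seq_direct_sum T n \<alpha> \<beta> \<gamma>"
proof -
  note ha = sigma_seq_hom[OF a] and hb = sigma_seq_hom[OF b]
  \<comment> \<open>The bound on \<open>k\<close> stands inside the quantifiers, so that choice
    yields total functions of \<open>k\<close>.\<close>
  have "\<forall>k. \<exists>S i1 i2 p1 p2. k < n \<longrightarrow>
    biproduct T (Dom T (\<alpha> ! k)) (Dom T (\<beta> ! k)) S i1 i2 p1 p2"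
    using biproduct_exists ha(4) hb(4) by meson
  then obtain S i1 i2 p1 p2 where bi: "\<And>k. k < n \<Longrightarrow>
    biproduct T (Dom T (\<alpha> ! k)) (Dom T (\<beta> ! k)) (S k) (i1 k) (i2 k) (p1 k) (p2 k)"
    by metis
  \<comment> \<open>All morphisms are diagonal. The last one ends in \<open>SO T (S 0)\<close>, a
    biproduct whose injections are the suspended injections at index 0.\<close>
  define m where "m k = (if Suc k < n
    then (i1 (Suc k) \<cdot> \<alpha> ! k \<cdot> p1 k) \<boxplus> (i2 (Suc k) \<cdot> \<beta> ! k \<cdot> p2 k)
    else (SA T (i1 0) \<cdot> \<alpha> ! k \<cdot> p1 k) \<boxplus> (SA T (i2 0) \<cdot> \<beta> ! k \<cdot> p2 k))" for k
  let ?\<gamma> = "map m [0..<n]"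
  have g: "?\<gamma> ! k = m k" if "k < n" for k using that by simp
  have n0: "0 < n" "n - 1 < n" using n_ge_3 by auto
  have m1: "m k \<in> Hom T (S k) (S (Suc k))" "m k \<cdot> i1 k = i1 (Suc k) \<cdot> \<alpha> ! k"
    "m k \<cdot> i2 k = i2 (Suc k) \<cdot> \<beta> ! k" "p1 (Suc k) \<cdot> m k = \<alpha> ! k \<cdot> p1 k"
    "p2 (Suc k) \<cdot> m k = \<beta> ! k \<cdot> p2 k" if k: "Suc k < n" for k
    using biproduct_map[OF bi[OF Suc_lessD[OF k]] bi[OF k] ha(2)[OF k] hb(2)[OF k]] k
    by (simp_all add: m_def)
  have m2: "m (n - 1) \<in> Hom T (S (n - 1)) (SO T (S 0))"
    "m (n - 1) \<cdot> i1 (n - 1) = SA T (i1 0) \<cdot> \<alpha> ! (n - 1)"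
    "m (n - 1) \<cdot> i2 (n - 1) = SA T (i2 0) \<cdot> \<beta> ! (n - 1)"
    "SA T (p1 0) \<cdot> m (n - 1) = \<alpha> ! (n - 1) \<cdot> p1 (n - 1)"
    "SA T (p2 0) \<cdot> m (n - 1) = \<beta> ! (n - 1) \<cdot> p2 (n - 1)"
    using biproduct_map[OF bi[OF n0(2)] SA_biproduct[OF bi[OF n0(1)]] ha(3) hb(3)] n0
    by (simp_all add: m_def)
  have sg: "sigma_seq T n ?\<gamma>" and D: "\<And>k. k < n \<Longrightarrow> Dom T (?\<gamma> ! k) = S k"
    using sigma_seqI[of ?\<gamma> S] m1(1) m2(1) n0 by auto
  have Dm: "Dom T (m k) = S k" if "k < n" for k
    using D[OF that] g[OF that] by simp
  have "seq_mor T n \<alpha> ?\<gamma> (map i1 [0..<n])" "seq_mor T n \<beta> ?\<gamma> (map i2 [0..<n])"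
    "seq_mor T n ?\<gamma> \<alpha> (map p1 [0..<n])" "seq_mor T n ?\<gamma> \<beta> (map p2 [0..<n])"
    using sg a b m1 m2 n0 bi Dm unfolding seq_mor_def by (auto simp: biproduct_def)
  then have "seq_direct_sum T n \<alpha> \<beta> ?\<gamma>"
    unfolding seq_direct_sum_def using bi Dm
    by (intro exI[of _ "map i1 [0..<n]"] exI[of _ "map i2 [0..<n]"]
        exI[of _ "map p1 [0..<n]"] exI[of _ "map p2 [0..<n]"]) simp
  then show ?thesis by blast
qed

end

section \<open>Almost \<open>n\<close>-exact structures and the typing of their
  \<open>n\<close>-angles\<close>

locale almost_n_exact_structure = n_angulated_category T n for T (structure) and n +
  fixes \<A> \<EE>
  assumes sub_obj: "\<A> \<subseteq> Obj T"
    and almost_exact: "almost_n_exact T n \<A> \<EE>"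
begin

lemmas EE_parts = almost_exact[unfolded almost_n_exact_def]

lemma EE_angles_in: "\<alpha> \<in> \<EE> \<Longrightarrow> \<alpha> \<in> angles_in T n \<A>"
  by (rule subsetD[OF EE_parts[THEN conjunct1]])

lemma EE_direct_sum:
  "\<alpha> \<in> \<EE> \<Longrightarrow> \<beta> \<in> \<EE> \<Longrightarrow> seq_direct_sum T n \<alpha> \<beta> \<gamma> \<Longrightarrow> \<gamma> \<in> \<EE>"
  by (rule EE_parts[THEN conjunct2, THEN conjunct1, rule_format])

lemma EE_pullback:
  assumes "\<alpha> \<in> \<EE>" "f \<in> sub_arr T \<A>" "Cod T f = Dom T (\<alpha> ! (n - 1))" "\<beta> \<in> Angles T"
    "Dom T (\<beta> ! 0) = Dom T (\<alpha> ! 0)" "\<beta> ! (n - 1) = \<alpha> ! (n - 1) \<cdot> f"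
    "seq_mor T n \<beta> \<alpha> \<phi>" "\<phi> ! 0 = Ide T (Dom T (\<alpha> ! 0))" "\<phi> ! (n - 1) = f"
  shows "\<beta> \<in> \<EE>"
  by (rule EE_parts[THEN conjunct2, THEN conjunct2, THEN conjunct2, THEN conjunct1,
        rule_format, OF assms(1-4)
        conjI[OF assms(5) conjI[OF assms(6) conjI[OF assms(7) conjI[OF assms(8,9)]]]]])

lemma EE_pushout:
  assumes "\<alpha> \<in> \<EE>" "g \<in> sub_arr T \<A>" "Dom T g = Dom T (\<alpha> ! 0)" "\<beta> \<in> Angles T"
    "Dom T (\<beta> ! 0) = Cod T g" "\<beta> ! (n - 1) = SA T g \<cdot> \<alpha> ! (n - 1)"
    "seq_mor T n \<alpha> \<beta> \<phi>" "\<phi> ! 0 = g" "\<phi> ! (n - 1) = Ide T (Dom T (\<alpha> ! (n - 1)))"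
  shows "\<beta> \<in> \<EE>"
  by (rule EE_parts[THEN conjunct2, THEN conjunct2, THEN conjunct2, THEN conjunct2,
        rule_format, OF assms(1-4)
        conjI[OF assms(5) conjI[OF assms(6) conjI[OF assms(7) conjI[OF assms(8,9)]]]]])

lemma EE_angles: "\<alpha> \<in> \<EE> \<Longrightarrow> \<alpha> \<in> Angles T"
  using EE_angles_in[of \<alpha>] by (simp add: angles_in_def)

lemma EE_objects: "\<alpha> \<in> \<EE> \<Longrightarrow> k < n \<Longrightarrow> Dom T (\<alpha> ! k) \<in> \<A>"
  using EE_angles_in[of \<alpha>] by (simp add: angles_in_def)

lemma EE_seq: "\<alpha> \<in> \<EE> \<Longrightarrow> sigma_seq T n \<alpha>"
  by (rule angles_seq[OF EE_angles])

lemma EE_first: "\<alpha> \<in> \<EE> \<Longrightarrow> \<alpha> ! 0 \<in> Hom T (Dom T (\<alpha> ! 0)) (Dom T (\<alpha> ! 1))"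
  using sigma_seq_hom(2)[OF EE_seq, of \<alpha> 0] n_ge_3 by simp

lemma EE_last: "\<alpha> \<in> \<EE> \<Longrightarrow> \<alpha> ! (n - 1) \<in> Hom T (Dom T (\<alpha> ! (n - 1))) (SO T (Dom T (\<alpha> ! 0)))"
  using sigma_seq_hom(3)[OF EE_seq] .

lemma EE_penultimate:
  assumes "\<alpha> \<in> \<EE>"
  shows "\<alpha> ! (n - 2) \<in> Hom T (Dom T (\<alpha> ! (n - 2))) (Dom T (\<alpha> ! (n - 1)))"
proof -
  have "Suc (n - 2) = n - 1" "n - 1 < n" using n_ge_3 by auto
  then show ?thesis using sigma_seq_hom(2)[OF EE_seq[OF assms], of "n - 2"] by metis
qed

section \<open>Phantoms form an ideal\<close>

lemma phantomE:
  assumes "i \<in> phantoms n \<EE>"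
  obtains \<alpha> where "\<alpha> \<in> \<EE>" "\<alpha> ! (n - 1) = i"
    "i \<in> Hom T (Dom T (\<alpha> ! (n - 1))) (SO T (Dom T (\<alpha> ! 0)))"
    "Dom T i \<in> \<A>" "Dom T (\<alpha> ! 0) \<in> \<A>"
proof -
  obtain \<alpha> where \<alpha>: "\<alpha> \<in> \<EE>" "\<alpha> ! (n - 1) = i"
    using assms by (auto simp: phantoms_def)
  show thesis
    by (rule that[OF \<alpha>])
      (use EE_last[OF \<alpha>(1)] EE_objects[OF \<alpha>(1), of 0] EE_objects[OF \<alpha>(1), of "n - 1"] \<alpha>(2) n_ge_3
        in simp_all)
qed

lemma phantomI: "\<alpha> \<in> \<EE> \<Longrightarrow> \<alpha> ! (n - 1) \<in> phantoms n \<EE>"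
  unfolding phantoms_def by blast

text \<open>(N2) only judges a given \<open>n\<close>-angle together with a given morphism.
  \<open>angle_with_last\<close> supplies the former, and \<open>F3_last\<close>, with an identity
  on the first term, the latter.\<close>

lemma phantom_precomp:
  assumes "i \<in> phantoms n \<EE>" "f \<in> sub_arr T \<A>" "Cod T f = Dom T i"
  shows "i \<cdot> f \<in> phantoms n \<EE>"
proof -
  obtain \<alpha> where \<alpha>: "\<alpha> \<in> \<EE>" "\<alpha> ! (n - 1) = i"
    "i \<in> Hom T (Dom T (\<alpha> ! (n - 1))) (SO T (Dom T (\<alpha> ! 0)))" "Dom T (\<alpha> ! 0) \<in> \<A>"
    using phantomE[OF assms(1)] .
  have f: "f \<in> Hom T (Dom T f) (Dom T (\<alpha> ! (n - 1)))"
    using assms(2,3) \<alpha>(2) by (auto simp: sub_arr_def Hom_def)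
  have A: "Dom T (\<alpha> ! 0) \<in> Obj T" using \<alpha>(4) sub_obj by blast
  have c: "i \<cdot> f \<in> Hom T (Dom T f) (SO T (Dom T (\<alpha> ! 0)))"
    using comp_in[OF f \<alpha>(3)] .
  obtain \<beta> where \<beta>: "\<beta> \<in> Angles T" "Dom T (\<beta> ! 0) = Dom T (\<alpha> ! 0)" "\<beta> ! (n - 1) = i \<cdot> f"
    using angle_with_last[OF c A] by blast
  have "SA T (Ide T (Dom T (\<alpha> ! 0))) \<cdot> \<beta> ! (n - 1) = \<alpha> ! (n - 1) \<cdot> f"
    unfolding \<beta>(3) \<alpha>(2) SA_ide[OF A] by (rule ide_comp[OF c])
  moreover have "f \<in> Hom T (Dom T (\<beta> ! (n - 1))) (Dom T (\<alpha> ! (n - 1)))"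
    using f HomD(2)[OF c] \<beta>(3) by simp
  ultimately obtain \<phi> where \<phi>: "seq_mor T n \<beta> \<alpha> \<phi>" "\<phi> ! 0 = Ide T (Dom T (\<alpha> ! 0))" "\<phi> ! (n - 1) = f"
    using F3_last[OF \<beta>(1) EE_angles[OF \<alpha>(1)], of "Ide T (Dom T (\<alpha> ! 0))" f] ide_in[OF A] \<beta>(2)
    by auto
  have "\<beta> \<in> \<EE>"
    by (rule EE_pullback[OF \<alpha>(1) assms(2) HomD(3)[OF f] \<beta>(1,2) _ \<phi>]) (simp only: \<beta>(3) \<alpha>(2))
  then show ?thesis using phantomI[of \<beta>] \<beta>(3) by simp
qed

text \<open>The dual argument with (N3), where the identity sits on the last term.\<close>

lemma phantom_postcomp:
  assumes "i \<in> phantoms n \<EE>" "g \<in> sub_arr T \<A>" "Cod T i = SO T (Dom T g)"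
  shows "SA T g \<cdot> i \<in> phantoms n \<EE>"
proof -
  obtain \<alpha> where \<alpha>: "\<alpha> \<in> \<EE>" "\<alpha> ! (n - 1) = i"
    "i \<in> Hom T (Dom T (\<alpha> ! (n - 1))) (SO T (Dom T (\<alpha> ! 0)))" "Dom T (\<alpha> ! 0) \<in> \<A>"
    using phantomE[OF assms(1)] .
  have C: "Cod T g \<in> Obj T" using assms(2) sub_obj by (auto simp: sub_arr_def)
  \<comment> \<open>The codomain of a phantom shows only the suspension of the first object, so
    injectivity of \<open>SO\<close> is needed to match it with the domain of
    \<open>g\<close>.\<close>
  have dg: "Dom T g = Dom T (\<alpha> ! 0)"
    using SO_inj[of "Dom T g" "Dom T (\<alpha> ! 0)"] assms(2,3) HomD(3)[OF \<alpha>(3)] \<alpha>(4) sub_obj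
    by (auto simp: sub_arr_def)
  have g: "g \<in> Hom T (Dom T (\<alpha> ! 0)) (Cod T g)"
    using assms(2) dg by (auto simp: sub_arr_def Hom_def)
  have c: "SA T g \<cdot> i \<in> Hom T (Dom T (\<alpha> ! (n - 1))) (SO T (Cod T g))"
    using comp_in[OF \<alpha>(3) SA_in[OF g]] .
  obtain \<beta> where \<beta>: "\<beta> \<in> Angles T" "Dom T (\<beta> ! 0) = Cod T g" "\<beta> ! (n - 1) = SA T g \<cdot> i"
    using angle_with_last[OF c C] by blast
  have "SA T g \<cdot> \<alpha> ! (n - 1) = \<beta> ! (n - 1) \<cdot> Ide T (Dom T (\<alpha> ! (n - 1)))"
    using comp_ide[OF c] \<beta>(3) \<alpha>(2) by simp
  moreover have "Ide T (Dom T (\<alpha> ! (n - 1))) \<in> Hom T (Dom T (\<alpha> ! (n - 1))) (Dom T (\<beta> ! (n - 1)))"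
    using ide_in[OF hom_obj(1)[OF c]] HomD(2)[OF c] \<beta>(3) by simp
  ultimately obtain \<phi> where \<phi>: "seq_mor T n \<alpha> \<beta> \<phi>" "\<phi> ! 0 = g"
    "\<phi> ! (n - 1) = Ide T (Dom T (\<alpha> ! (n - 1)))"
    using F3_last[OF EE_angles[OF \<alpha>(1)] \<beta>(1), of g "Ide T (Dom T (\<alpha> ! (n - 1)))"] g \<beta>(2)
    by auto
  have "\<beta> \<in> \<EE>"
    by (rule EE_pushout[OF \<alpha>(1) assms(2) dg \<beta>(1,2) _ \<phi>]) (simp only: \<beta>(3) \<alpha>(2))
  then show ?thesis using phantomI[of \<beta>] \<beta>(3) by simp
qed

lemma phantom_add:
  assumes "i \<in> phantoms n \<EE>" "j \<in> phantoms n \<EE>" "Dom T i = Dom T j" "Cod T i = Cod T j"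
  shows "i \<boxplus> j \<in> phantoms n \<EE>"
proof -
  obtain \<alpha> where \<alpha>: "\<alpha> \<in> \<EE>" "\<alpha> ! (n - 1) = i"
    "i \<in> Hom T (Dom T (\<alpha> ! (n - 1))) (SO T (Dom T (\<alpha> ! 0)))" "Dom T i \<in> \<A>" "Dom T (\<alpha> ! 0) \<in> \<A>"
    using phantomE[OF assms(1)] .
  obtain \<beta> where \<beta>: "\<beta> \<in> \<EE>" "\<beta> ! (n - 1) = j"
    "j \<in> Hom T (Dom T (\<beta> ! (n - 1))) (SO T (Dom T (\<beta> ! 0)))" "Dom T (\<beta> ! 0) \<in> \<A>"
    using phantomE[OF assms(2)] .
  define A where "A = Dom T i"
  define B where "B = Dom T (\<alpha> ! 0)"
  have "Dom T (\<beta> ! 0) = B"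
    using SO_inj[of "Dom T (\<beta> ! 0)" B] HomD(3)[OF \<alpha>(3)] HomD(3)[OF \<beta>(3)] assms(4) \<alpha>(5) \<beta>(4) sub_obj
    by (auto simp: B_def)
  then have D: "Dom T (\<alpha> ! 0) = B" "Dom T (\<beta> ! 0) = B"
    "Dom T (\<alpha> ! (n - 1)) = A" "Dom T (\<beta> ! (n - 1)) = A"
    using \<alpha>(2) \<beta>(2) assms(3) by (auto simp: A_def B_def)
  have i: "i \<in> Hom T A (SO T B)" and j: "j \<in> Hom T A (SO T B)"
    using \<alpha>(3) \<beta>(3) D by simp_all
  have AB: "A \<in> \<A>" "B \<in> \<A>" "B \<in> Obj T"
    using \<alpha>(4,5) sub_obj by (auto simp: A_def B_def)
  obtain \<gamma> where \<gamma>: "seq_direct_sum T n \<alpha> \<beta> \<gamma>"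
    using seq_direct_sum_exists[OF EE_seq[OF \<alpha>(1)] EE_seq[OF \<beta>(1)]] by blast
  have \<gamma>E: "\<gamma> \<in> \<EE>"
    by (rule EE_direct_sum[OF \<alpha>(1) \<beta>(1) \<gamma>])
  obtain i1 i2 p1 p2 where m: "seq_mor T n \<alpha> \<gamma> i1" "seq_mor T n \<beta> \<gamma> i2"
    and bi: "\<forall>k<n. biproduct T (Dom T (\<alpha> ! k)) (Dom T (\<beta> ! k)) (Dom T (\<gamma> ! k))
        (i1 ! k) (i2 ! k) (p1 ! k) (p2 ! k)"
    using \<gamma> unfolding seq_direct_sum_def by blast
  define S where "S = Dom T (\<gamma> ! 0)"
  define R where "R = Dom T (\<gamma> ! (n - 1))"
  \<comment> \<open>Because \<gamma> belongs to \<EE>, the outer biproducts lie in \<A>; hence the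
    diagonal and codiagonal below are morphisms of \<A>.\<close>
  have SR: "S \<in> \<A>" "R \<in> \<A>"
    using EE_objects[OF \<gamma>E] n_ge_3 by (auto simp: S_def R_def)
  have b0: "biproduct T B B S (i1 ! 0) (i2 ! 0) (p1 ! 0) (p2 ! 0)"
    and b1: "biproduct T A A R (i1 ! (n - 1)) (i2 ! (n - 1)) (p1 ! (n - 1)) (p2 ! (n - 1))"
    using bi[rule_format, of 0] bi[rule_format, of "n - 1"] n_ge_3 D by (auto simp: S_def R_def)
  let ?c = "\<gamma> ! (n - 1)"
  have c: "?c \<in> Hom T R (SO T S)"
    using EE_last[OF \<gamma>E] by (simp add: S_def R_def)
  \<comment> \<open>\<open>d\<close> is the diagonal into the biproduct \<open>R\<close> of two
    copies of \<open>A\<close>, and \<open>s\<close> the codiagonal of the biproduct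
    \<open>S\<close> of two copies of \<open>B\<close>.\<close>
  define d where "d = i1 ! (n - 1) \<boxplus> i2 ! (n - 1)"
  define s where "s = p1 ! 0 \<boxplus> p2 ! 0"
  have h1: "i1 ! (n - 1) \<in> Hom T A R" "i2 ! (n - 1) \<in> Hom T A R"
    and h0: "i1 ! 0 \<in> Hom T B S" "i2 ! 0 \<in> Hom T B S" "p1 ! 0 \<in> Hom T S B" "p2 ! 0 \<in> Hom T S B"
    using b0 b1 by (auto simp: biproduct_def)
  have d: "d \<in> Hom T A R" and s: "s \<in> Hom T S B"
    using add_in h1 h0 by (auto simp: d_def s_def)
  have ni: "s \<cdot> i1 ! 0 = Ide T B" "s \<cdot> i2 ! 0 = Ide T B"
    using add_comp[OF h0(1) h0(3,4)] add_comp[OF h0(2) h0(3,4)] add_zero[OF ide_in[OF AB(3)]] b0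
    by (simp_all add: s_def biproduct_def)
  \<comment> \<open>The closing squares of the two injections, which are morphisms of
    sequences.\<close>
  have sq: "?c \<cdot> i1 ! (n - 1) = SA T (i1 ! 0) \<cdot> i" "?c \<cdot> i2 ! (n - 1) = SA T (i2 ! 0) \<cdot> j"
    using m \<alpha>(2) \<beta>(2) by (simp_all add: seq_mor_def)
  have "SA T s \<cdot> SA T (i1 ! 0) \<cdot> i = i" "SA T s \<cdot> SA T (i2 ! 0) \<cdot> j = j"
    using comp_assoc[OF i SA_in[OF h0(1)] SA_in[OF s]] SA_comp[OF h0(1) s] ide_comp[OF i]
      comp_assoc[OF j SA_in[OF h0(2)] SA_in[OF s]] SA_comp[OF h0(2) s] ide_comp[OF j]
      ni SA_ide[OF AB(3)] by simp_all
  then have "SA T s \<cdot> ?c \<cdot> d = i \<boxplus> j"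
    using comp_add[OF h1 c] sq comp_in[OF i SA_in[OF h0(1)]] comp_in[OF j SA_in[OF h0(2)]]
      comp_add[OF _ _ SA_in[OF s], of "SA T (i1 ! 0) \<cdot> i" A "SA T (i2 ! 0) \<cdot> j"]
    by (simp add: d_def)
  moreover have "SA T s \<cdot> ?c \<cdot> d \<in> phantoms n \<EE>"
  proof -
    have "d \<in> sub_arr T \<A>" "s \<in> sub_arr T \<A>"
      using HomD[OF d] HomD[OF s] AB SR by (simp_all add: sub_arr_def)
    then show ?thesis
      using phantom_precomp[OF phantomI[OF \<gamma>E], of d] phantom_postcomp[of "?c \<cdot> d" s]
        HomD[OF d] HomD[OF s] HomD[OF c] HomD[OF comp_in[OF d c]] by simp
  qed
  ultimately show ?thesis by simp
qed

lemma phantom_ideal_phantoms: "phantom_ideal T \<A> (phantoms n \<EE>)"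
  unfolding phantom_ideal_def
proof (intro conjI ballI impI)
  fix i assume "i \<in> phantoms n \<EE>"
  then obtain \<alpha> where "i \<in> Hom T (Dom T (\<alpha> ! (n - 1))) (SO T (Dom T (\<alpha> ! 0)))"
    "Dom T i \<in> \<A>" "Dom T (\<alpha> ! 0) \<in> \<A>"
    by (rule phantomE)
  then show "i \<in> Arr T" "Dom T i \<in> \<A>" "Cod T i \<in> SO T ` \<A>"
    by (auto simp: Hom_def)
next
  fix i j assume "i \<in> phantoms n \<EE>" "j \<in> phantoms n \<EE>" "Dom T i = Dom T j \<and> Cod T i = Cod T j"
  then show "i \<boxplus> j \<in> phantoms n \<EE>" using phantom_add by blast
next
  fix i f g assume i: "i \<in> phantoms n \<EE>" and f: "f \<in> sub_arr T \<A>" and g: "g \<in> sub_arr T \<A>"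
    and c: "Cod T f = Dom T i \<and> Cod T i = SO T (Dom T g)"
  \<comment> \<open>Precomposition leaves the codomain unchanged, which is what
    \<open>phantom_postcomp\<close> asks for next.\<close>
  have "i \<cdot> f \<in> Hom T (Dom T f) (Cod T i)"
    using phantomE[OF i] f c comp_in[of f "Dom T f" "Dom T i" i "Cod T i"]
    by (auto simp: sub_arr_def Hom_def)
  then show "SA T g \<cdot> i \<cdot> f \<in> phantoms n \<EE>"
    using phantom_precomp[OF i f] phantom_postcomp[OF _ g] c HomD(3) by metis
qed

section \<open>Injective inflations versus precovers, projective deflations versus
  preenvelopes\<close>

text \<open>Inflations out of \<open>A\<close> and phantoms into \<open>SO T A\<close> both come
  from some \<beta> in \<EE> starting at \<open>A\<close>. Either factorization yields a morphism
  from \<beta> to \<alpha> that is the identity on \<open>A\<close>; its first square and its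
  closing square express the two factorizations.\<close>

lemma injective_inflation_iff_precover:
  assumes \<alpha>: "\<alpha> \<in> \<EE>"
  shows "injective_mor T \<A> \<EE> (\<alpha> ! 0) \<longleftrightarrow>
    precover T (phantoms n \<EE>) (SO T (Dom T (\<alpha> ! 0))) (\<alpha> ! (n - 1))"
proof -
  define A where "A = Dom T (\<alpha> ! 0)"
  have A: "A \<in> Obj T"
    using subsetD[OF sub_obj EE_objects[OF \<alpha>, of 0]] n_ge_3 by (simp add: A_def)
  have e: "\<alpha> ! 0 \<in> Hom T A (Dom T (\<alpha> ! 1))"
    and p: "\<alpha> ! (n - 1) \<in> Hom T (Dom T (\<alpha> ! (n - 1))) (SO T A)"
    unfolding A_def by (rule EE_first[OF \<alpha>], rule EE_last[OF \<alpha>])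
  have pre: "\<exists>h\<in>Hom T (Dom T i) (Dom T (\<alpha> ! (n - 1))). i = \<alpha> ! (n - 1) \<cdot> h"
    if inj: "injective_mor T \<A> \<EE> (\<alpha> ! 0)" and i: "i \<in> phantoms n \<EE>" "Cod T i = SO T A" for i
  proof -
    obtain \<beta> where \<beta>: "\<beta> \<in> \<EE>" "\<beta> ! (n - 1) = i"
      "i \<in> Hom T (Dom T (\<beta> ! (n - 1))) (SO T (Dom T (\<beta> ! 0)))" "Dom T (\<beta> ! 0) \<in> \<A>"
      using phantomE[OF i(1)] .
    have B: "Dom T (\<beta> ! 0) = A"
      by (rule SO_inj[OF subsetD[OF sub_obj \<beta>(4)] A]) (simp only: HomD(3)[OF \<beta>(3), symmetric] i(2))
    have "\<beta> ! 0 \<in> inflations \<EE>" using \<beta>(1) by (auto simp: inflations_def)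
    moreover have "Dom T (\<beta> ! 0) = Dom T (\<alpha> ! 0)" using B A_def by (rule trans)
    ultimately obtain h where "h \<in> Hom T (Cod T (\<beta> ! 0)) (Cod T (\<alpha> ! 0))" and h: "\<alpha> ! 0 = h \<cdot> \<beta> ! 0"
      using inj unfolding injective_mor_def by blast
    then have hh: "h \<in> Hom T (Dom T (\<beta> ! 1)) (Dom T (\<alpha> ! 1))"
      unfolding HomD(3)[OF e] HomD(3)[OF EE_first[OF \<beta>(1)]] by blast
    have "h \<cdot> \<beta> ! 0 = \<alpha> ! 0 \<cdot> Ide T A"
      by (simp only: comp_ide[OF e] h[symmetric])
    moreover have "Ide T A \<in> Hom T (Dom T (\<beta> ! 0)) (Dom T (\<alpha> ! 0))"
      unfolding B A_def[symmetric] by (rule ide_in[OF A])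
    \<comment> \<open>The factor \<open>h\<close> of the inflation serves as second component; the
      last component of \<phi> will be the factor of the phantom.\<close>
    ultimately obtain \<phi> where \<phi>: "seq_mor T n \<beta> \<alpha> \<phi>" "\<phi> ! 0 = Ide T A"
      using F3[OF EE_angles[OF \<beta>(1)] EE_angles[OF \<alpha>] _ hh] by blast
    have sq: "SA T (\<phi> ! 0) \<cdot> \<beta> ! (n - 1) = \<alpha> ! (n - 1) \<cdot> \<phi> ! (n - 1)"
      and d: "\<phi> ! (n - 1) \<in> Hom T (Dom T (\<beta> ! (n - 1))) (Dom T (\<alpha> ! (n - 1)))"
      using \<phi>(1) n_ge_3 by (simp_all add: seq_mor_def)
    have "SA T (Ide T A) \<cdot> i = i"
      using ide_comp[OF \<beta>(3)] unfolding B SA_ide[OF A] .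
    then have "i = \<alpha> ! (n - 1) \<cdot> \<phi> ! (n - 1)"
      using sq unfolding \<phi>(2) \<beta>(2) by (rule trans[OF sym])
    then show ?thesis using d unfolding \<beta>(2) by (rule bexI)
  qed
  have inj: "\<exists>h\<in>Hom T (Cod T x) (Cod T (\<alpha> ! 0)). \<alpha> ! 0 = h \<cdot> x"
    if pre: "precover T (phantoms n \<EE>) (SO T A) (\<alpha> ! (n - 1))"
      and x: "x \<in> inflations \<EE>" "Dom T x = A" for x
  proof -
    obtain \<beta> where \<beta>: "\<beta> \<in> \<EE>" "\<beta> ! 0 = x"
      using x by (auto simp: inflations_def)
    have q: "\<beta> ! (n - 1) \<in> Hom T (Dom T (\<beta> ! (n - 1))) (SO T A)"
      using EE_last[OF \<beta>(1)] unfolding \<beta>(2) x(2) .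
    obtain h where h: "h \<in> Hom T (Dom T (\<beta> ! (n - 1))) (Dom T (\<alpha> ! (n - 1)))"
      "\<beta> ! (n - 1) = \<alpha> ! (n - 1) \<cdot> h"
      using pre phantomI[OF \<beta>(1)] HomD(3)[OF q] unfolding precover_def by blast
    have "SA T (Ide T A) \<cdot> \<beta> ! (n - 1) = \<alpha> ! (n - 1) \<cdot> h"
      unfolding SA_ide[OF A] ide_comp[OF q] by (rule h(2))
    moreover have "Ide T A \<in> Hom T (Dom T (\<beta> ! 0)) (Dom T (\<alpha> ! 0))"
      unfolding \<beta>(2) x(2) A_def[symmetric] by (rule ide_in[OF A])
    \<comment> \<open>Now \<open>h\<close> serves as last component, and the second component of
      \<phi> will be the factor of the inflation.\<close>
    ultimately obtain \<phi> where \<phi>: "seq_mor T n \<beta> \<alpha> \<phi>" "\<phi> ! 0 = Ide T A"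
      using F3_last[OF EE_angles[OF \<beta>(1)] EE_angles[OF \<alpha>] _ h(1)] by blast
    have sq: "\<phi> ! Suc 0 \<cdot> \<beta> ! 0 = \<alpha> ! 0 \<cdot> \<phi> ! 0"
      and d: "\<phi> ! Suc 0 \<in> Hom T (Dom T (\<beta> ! 1)) (Dom T (\<alpha> ! 1))"
      using \<phi>(1) n_ge_3 by (simp_all add: seq_mor_def)
    have "\<alpha> ! 0 = \<phi> ! Suc 0 \<cdot> x"
      using sq unfolding \<phi>(2) \<beta>(2) comp_ide[OF e] by (rule sym)
    moreover have "\<phi> ! Suc 0 \<in> Hom T (Cod T x) (Cod T (\<alpha> ! 0))"
      using d HomD(3)[OF e] HomD(3)[OF EE_first[OF \<beta>(1)]] \<beta>(2) by simp
    ultimately show ?thesis by (rule bexI)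
  qed
  have "\<alpha> ! 0 \<in> sub_arr T \<A>"
    using HomD[OF e] EE_objects[OF \<alpha>, of 0] EE_objects[OF \<alpha>, of 1] n_ge_3
    by (simp add: sub_arr_def)
  then show ?thesis
    using pre inj phantomI[OF \<alpha>] HomD[OF p]
    unfolding injective_mor_def precover_def A_def[symmetric] by blast
qed

text \<open>Dually, the morphisms run from \<alpha> to \<beta> and are the identity on the common
  last object \<open>C\<close>; the square on the last two terms is exchanged with the closing
  square.\<close>

lemma projective_deflation_iff_preenvelope:
  assumes \<alpha>: "\<alpha> \<in> \<EE>"
  shows "projective_mor T n \<A> \<EE> (\<alpha> ! (n - 2)) \<longleftrightarrow>
    preenvelope T (phantoms n \<EE>) (Dom T (\<alpha> ! (n - 1))) (\<alpha> ! (n - 1))"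
proof -
  define C where "C = Dom T (\<alpha> ! (n - 1))"
  have C: "C \<in> Obj T"
    using subsetD[OF sub_obj EE_objects[OF \<alpha>, of "n - 1"]] n_ge_3 by (simp add: C_def)
  have d: "\<alpha> ! (n - 2) \<in> Hom T (Dom T (\<alpha> ! (n - 2))) C"
    and p: "\<alpha> ! (n - 1) \<in> Hom T C (SO T (Dom T (\<alpha> ! 0)))"
    unfolding C_def by (rule EE_penultimate[OF \<alpha>], rule EE_last[OF \<alpha>])
  have pre: "\<exists>h\<in>Hom T (Cod T (\<alpha> ! (n - 1))) (Cod T i). i = h \<cdot> \<alpha> ! (n - 1)"
    if proj: "projective_mor T n \<A> \<EE> (\<alpha> ! (n - 2))"
      and i: "i \<in> phantoms n \<EE>" "Dom T i = C" for i
  proof -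
    obtain \<beta> where \<beta>: "\<beta> \<in> \<EE>" "\<beta> ! (n - 1) = i"
      "i \<in> Hom T (Dom T (\<beta> ! (n - 1))) (SO T (Dom T (\<beta> ! 0)))"
      using phantomE[OF i(1)] .
    have B: "Dom T (\<beta> ! (n - 1)) = C" unfolding \<beta>(2) by (rule i(2))
    have "\<beta> ! (n - 2) \<in> deflations n \<EE>" using \<beta>(1) by (auto simp: deflations_def)
    moreover have "Cod T (\<beta> ! (n - 2)) = Cod T (\<alpha> ! (n - 2))"
      unfolding HomD(3)[OF d] HomD(3)[OF EE_penultimate[OF \<beta>(1)]] by (rule B)
    ultimately obtain h where h: "h \<in> Hom T (Dom T (\<alpha> ! (n - 2))) (Dom T (\<beta> ! (n - 2)))"
      "\<alpha> ! (n - 2) = \<beta> ! (n - 2) \<cdot> h"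
      using proj unfolding projective_mor_def by blast
    have "Ide T C \<cdot> \<alpha> ! (n - 2) = \<beta> ! (n - 2) \<cdot> h"
      unfolding ide_comp[OF d] by (rule h(2))
    moreover have "Ide T C \<in> Hom T (Dom T (\<alpha> ! (n - 1))) (Dom T (\<beta> ! (n - 1)))"
      unfolding B C_def[symmetric] by (rule ide_in[OF C])
    \<comment> \<open>The first component of the completion is enough: its suspension is the factor
      of the phantom.\<close>
    ultimately obtain f where f: "f \<in> Hom T (Dom T (\<alpha> ! 0)) (Dom T (\<beta> ! 0))"
      "SA T f \<cdot> \<alpha> ! (n - 1) = \<beta> ! (n - 1) \<cdot> Ide T C"
      using F3_last_two[OF EE_angles[OF \<alpha>] EE_angles[OF \<beta>(1)] h(1)] by blast
    have "i = SA T f \<cdot> \<alpha> ! (n - 1)"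
      using comp_ide[OF \<beta>(3)] unfolding f(2) \<beta>(2) i(2) by (rule sym)
    moreover have "SA T f \<in> Hom T (Cod T (\<alpha> ! (n - 1))) (Cod T i)"
      unfolding HomD(3)[OF p] HomD(3)[OF \<beta>(3)] by (rule SA_in[OF f(1)])
    ultimately show ?thesis by (rule bexI)
  qed
  have proj: "\<exists>h\<in>Hom T (Dom T (\<alpha> ! (n - 2))) (Dom T x). \<alpha> ! (n - 2) = x \<cdot> h"
    if pre: "preenvelope T (phantoms n \<EE>) C (\<alpha> ! (n - 1))"
      and x: "x \<in> deflations n \<EE>" "Cod T x = Cod T (\<alpha> ! (n - 2))" for x
  proof -
    obtain \<beta> where \<beta>: "\<beta> \<in> \<EE>" "\<beta> ! (n - 2) = x"
      using x by (auto simp: deflations_def)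
    have B: "Dom T (\<beta> ! (n - 1)) = C"
      using x(2) \<beta>(2) HomD(3)[OF d] HomD(3)[OF EE_penultimate[OF \<beta>(1)]] by simp
    have q: "\<beta> ! (n - 1) \<in> Hom T C (SO T (Dom T (\<beta> ! 0)))"
      using EE_last[OF \<beta>(1)] unfolding B .
    obtain h where "h \<in> Hom T (Cod T (\<alpha> ! (n - 1))) (Cod T (\<beta> ! (n - 1)))"
      and h: "\<beta> ! (n - 1) = h \<cdot> \<alpha> ! (n - 1)"
      using pre phantomI[OF \<beta>(1)] B unfolding preenvelope_def by blast
    then have "h \<in> Hom T (SO T (Dom T (\<alpha> ! 0))) (SO T (Dom T (\<beta> ! 0)))"
      unfolding HomD(3)[OF p] HomD(3)[OF q] by blast
    \<comment> \<open>The factor of a phantom runs between suspended objects, so fullness of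
      \<open>SA\<close> is used to turn it into a first component.\<close>
    then obtain g where g: "g \<in> Hom T (Dom T (\<alpha> ! 0)) (Dom T (\<beta> ! 0))" "SA T g = h"
      by (rule SA_surj) (use sigma_seq_hom(4)[OF EE_seq] \<alpha> \<beta>(1) n_ge_3 in auto)
    have "SA T g \<cdot> \<alpha> ! (n - 1) = \<beta> ! (n - 1) \<cdot> Ide T C"
      unfolding comp_ide[OF q] g(2) by (rule h[symmetric])
    moreover have "Ide T C \<in> Hom T (Dom T (\<alpha> ! (n - 1))) (Dom T (\<beta> ! (n - 1)))"
      unfolding B C_def[symmetric] by (rule ide_in[OF C])
    ultimately obtain \<phi> where \<phi>: "seq_mor T n \<alpha> \<beta> \<phi>" "\<phi> ! (n - 1) = Ide T C"
      using F3_last[OF EE_angles[OF \<alpha>] EE_angles[OF \<beta>(1)] g(1)] by blast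
    \<comment> \<open>The relevant square has index \<open>n - 2\<close>; subtraction is truncated,
      so these identities draw on \<open>3 \<le> n\<close>.\<close>
    have s: "Suc (n - 2) = n - 1" "Suc (n - 2) < n" "n - 2 < n" using n_ge_3 by auto
    have "\<phi> ! Suc (n - 2) \<cdot> \<alpha> ! (n - 2) = \<beta> ! (n - 2) \<cdot> \<phi> ! (n - 2)"
      and hh: "\<phi> ! (n - 2) \<in> Hom T (Dom T (\<alpha> ! (n - 2))) (Dom T (\<beta> ! (n - 2)))"
      using \<phi>(1) s(2,3) unfolding seq_mor_def by blast+
    then have "\<alpha> ! (n - 2) = x \<cdot> \<phi> ! (n - 2)"
      unfolding s(1) \<phi>(2) \<beta>(2) ide_comp[OF d] by blast
    then show ?thesis using hh unfolding \<beta>(2) by (rule bexI)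
  qed
  have "\<alpha> ! (n - 2) \<in> sub_arr T \<A>"
    using HomD[OF d] EE_objects[OF \<alpha>, of "n - 2"] EE_objects[OF \<alpha>, of "n - 1"] n_ge_3
    by (simp add: sub_arr_def C_def)
  then show ?thesis
    using pre proj phantomI[OF \<alpha>] HomD[OF p]
    unfolding projective_mor_def preenvelope_def C_def[symmetric] by blast
qed

section \<open>From single \<open>n\<close>-angles to all objects\<close>

text \<open>An \<open>n\<close>-angle in \<EE> that provides the required inflation also provides
  the required phantom, and conversely, so the equivalence for a single \<open>n\<close>-angle is
  applied object by object.\<close>

lemma enough_injectives_iff:
  "enough_injective_mors T \<A> \<EE> \<longleftrightarrow> precovering T \<A> (phantoms n \<EE>)"
proof
  assume *: "enough_injective_mors T \<A> \<EE>"
  have "\<exists>\<phi>. precover T (phantoms n \<EE>) (SO T A) \<phi>" if A: "A \<in> \<A>" for A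
  proof -
    obtain \<alpha> where "\<alpha> \<in> \<EE>" "Dom T (\<alpha> ! 0) = A" "injective_mor T \<A> \<EE> (\<alpha> ! 0)"
      using * A unfolding enough_injective_mors_def inflations_def by blast
    then show ?thesis using injective_inflation_iff_precover by blast
  qed
  then show "precovering T \<A> (phantoms n \<EE>)" by (simp add: precovering_def)
next
  assume *: "precovering T \<A> (phantoms n \<EE>)"
  have "\<exists>e\<in>inflations \<EE>. Dom T e = A \<and> injective_mor T \<A> \<EE> e" if A: "A \<in> \<A>" for A
  proof -
    obtain p where p: "precover T (phantoms n \<EE>) (SO T A) p"
      using * A unfolding precovering_def by blast
    then have "p \<in> phantoms n \<EE>" by (simp add: precover_def)
    then obtain \<alpha> where \<alpha>: "\<alpha> \<in> \<EE>" "\<alpha> ! (n - 1) = p"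
      "p \<in> Hom T (Dom T (\<alpha> ! (n - 1))) (SO T (Dom T (\<alpha> ! 0)))" "Dom T (\<alpha> ! 0) \<in> \<A>"
      by (rule phantomE)
    \<comment> \<open>The precover determines the first object only up to \<open>SO\<close>, which
      is injective on objects.\<close>
    have "Dom T (\<alpha> ! 0) = A"
      using SO_inj[of "Dom T (\<alpha> ! 0)" A] HomD(3)[OF \<alpha>(3)] p \<alpha>(4) A sub_obj
      by (auto simp: precover_def)
    then show ?thesis
      using \<alpha>(1,2) p injective_inflation_iff_precover[OF \<alpha>(1)] unfolding inflations_def by blast
  qed
  then show "enough_injective_mors T \<A> \<EE>" by (simp add: enough_injective_mors_def)
qed

text \<open>The same passage, with the last object of the \<open>n\<close>-angle as meeting point:
  it is the codomain of the deflation and the domain of the phantom.\<close>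

lemma enough_projectives_iff:
  "enough_projective_mors T n \<A> \<EE> \<longleftrightarrow> preenveloping T \<A> (phantoms n \<EE>)"
proof
  assume *: "enough_projective_mors T n \<A> \<EE>"
  have "\<exists>\<phi>. preenvelope T (phantoms n \<EE>) C \<phi>" if C: "C \<in> \<A>" for C
  proof -
    obtain \<alpha> where \<alpha>: "\<alpha> \<in> \<EE>" "Cod T (\<alpha> ! (n - 2)) = C"
      "projective_mor T n \<A> \<EE> (\<alpha> ! (n - 2))"
      using * C unfolding enough_projective_mors_def deflations_def by blast
    then have "Dom T (\<alpha> ! (n - 1)) = C"
      using HomD(3)[OF EE_penultimate[OF \<alpha>(1)]] by simp
    then show ?thesis
      using projective_deflation_iff_preenvelope[OF \<alpha>(1)] \<alpha>(3) by blast
  qed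
  then show "preenveloping T \<A> (phantoms n \<EE>)" by (simp add: preenveloping_def)
next
  assume *: "preenveloping T \<A> (phantoms n \<EE>)"
  have "\<exists>d\<in>deflations n \<EE>. Cod T d = C \<and> projective_mor T n \<A> \<EE> d" if C: "C \<in> \<A>" for C
  proof -
    obtain p where p: "preenvelope T (phantoms n \<EE>) C p"
      using * C unfolding preenveloping_def by blast
    then have "p \<in> phantoms n \<EE>" by (simp add: preenvelope_def)
    then obtain \<alpha> where \<alpha>: "\<alpha> \<in> \<EE>" "\<alpha> ! (n - 1) = p"
      by (rule phantomE)
    have "Dom T (\<alpha> ! (n - 1)) = C"
      using \<alpha>(2) p by (auto simp: preenvelope_def)
    then show ?thesis
      using \<alpha>(1,2) p projective_deflation_iff_preenvelope[OF \<alpha>(1)] HomD(3)[OF EE_penultimate[OF \<alpha>(1)]]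
      unfolding deflations_def by blast
  qed
  then show "enough_projective_mors T n \<A> \<EE>" by (simp add: enough_projective_mors_def)
qed

end

theorem theorem3p4:
  fixes T :: "('o, 'm, 'x) ang_cat_scheme" and n :: nat
    and \<A> :: "'o set" and \<EE> :: "'m list set"
  assumes "n_angulated_category T n"
    and "ext_closed_subcategory T n \<A>"
    and "almost_n_exact T n \<A> \<EE>"
  shows "(enough_injective_mors T \<A> \<EE> \<longleftrightarrow>
            phantom_ideal T \<A> (phantoms n \<EE>) \<and> precovering T \<A> (phantoms n \<EE>)) \<and>
         (enough_projective_mors T n \<A> \<EE> \<longleftrightarrow>
            phantom_ideal T \<A> (phantoms n \<EE>) \<and> preenveloping T \<A> (phantoms n \<EE>))"
proof -
  interpret almost_n_exact_structure T n \<A> \<EE>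
    using assms
    by (auto simp: almost_n_exact_structure_def almost_n_exact_structure_axioms_def
        ext_closed_subcategory_def)
  \<comment> \<open>\<open>phantom_ideal_phantoms\<close> settles the ideal condition in both parts,
    so each reduces to the equivalence with precovering or preenveloping.\<close>
  show ?thesis
    using phantom_ideal_phantoms enough_injectives_iff enough_projectives_iff by blast
qed

end
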